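(* Let $p,q$ be positive integers and $\varphi:[0,+\infty)\to(0,+\infty)$ a non-decreasing unbounded function. Let $f_1,f_2$ be meromorphic functions and $g_1$ an entire function such that at least one of $f_1,f_2$ is of regular relative $(p,q)$-$\varphi$ growth with respect to $g_1$. Suppose $g_1$ satisfies the Property (A). Then $$\lambda_{g_1}(f_1\cdot f_2)\le \max\{\lambda_{g_1}(f_1),\lambda_{g_1}(f_2)\}.$$ Equality holds when $\lambda_{g_1}(f_i)>\lambda_{g_1}(f_j)$ and $f_j$ is of regular relative $(p,q)$-$\varphi$ growth with respect to $g_1$, where $i,j\in\{1,2\}$, $i\ne j$.
   Context: Meromorphic and entire functions are on the whole plane $\mathbb{C}$. $M_g(r)=\max_{|z|=r}|g(z)|$, and $T_f(r)$ is the Nevanlinna characteristic function of $f$. For a non-constant entire $g$, $T_g$ is strictly increasing and continuous, with inverse $T_g^{-1}:(|g(0)|,\infty)\to(0,\infty)$, $\lim_{s\to\infty}T_g^{-1}(s)=\infty$. Iterated logarithms: $\log^{[0]}x=x$, $\log^{[k]}x=\log(\log^{[k-1]}x)$ for $k\ge1$. For fixed positive integers $p,q$ and fixed $\varphi$, the relative $(p,q)$-$\varphi$ order and lower order of a meromorphic $f$ with respect to an entire $g$ (full notation $\rho_g^{(p,q)}(f,\varphi)$, $\lambda_g^{(p,q)}(f,\varphi)$, abbreviated $\rho_g(f)$, $\lambda_g(f)$) are the $\limsup$ and the $\liminf$, respectively, as $r\to\infty$ of $\dfrac{\log^{[p]}T_g^{-1}(T_f(r))}{\log^{[q]}\varphi(r)}$.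 $f$ is of regular relative $(p,q)$-$\varphi$ growth with respect to $g$ if $\rho_g(f)=\lambda_g(f)$. A non-constant entire $g$ has the Property (A) if for every $\sigma>1$ and all sufficiently large $r$, $[M_g(r)]^2\le M_g(r^\sigma)$. Standing assumption: all growth indicators that occur are nonzero and finite. *)

theory Defs
  imports "HOL-Complex_Analysis.Complex_Analysis"
begin

definition log_plus :: "real \<Rightarrow> real" where
  "log_plus x = max 0 (ln x)"

(* Poles in the closed disc, counted with multiplicity. The values that f takes at its poles and
   removable singularities do not affect any of the quantities below. *)
definition pole_count :: "(complex \<Rightarrow> complex) \<Rightarrow> real \<Rightarrow> nat" where
  "pole_count f r = (\<Sum>z | is_pole f z \<and> cmod z \<le> r. nat (- zorder f z))"

(* The integrand vanishes near 0; at t = 0 it is 0 / 0 = 0. *)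
definition nevanlinna_N :: "(complex \<Rightarrow> complex) \<Rightarrow> real \<Rightarrow> real" where
  "nevanlinna_N f r =
     integral {0..r} (\<lambda>t. (real (pole_count f t) - real (pole_count f 0)) / t)
       + real (pole_count f 0) * ln r"

definition nevanlinna_m :: "(complex \<Rightarrow> complex) \<Rightarrow> real \<Rightarrow> real" where
  "nevanlinna_m f r =
     1 / (2 * pi) * integral {0..2 * pi} (\<lambda>\<theta>. log_plus (cmod (f (complex_of_real r * cis \<theta>))))"

definition nevanlinna_T :: "(complex \<Rightarrow> complex) \<Rightarrow> real \<Rightarrow> real" where
  "nevanlinna_T f r = nevanlinna_m f r + nevanlinna_N f r"

(* For non-constant entire g, every s > log_plus (cmod (g 0)), in particular every s > cmod (g 0),
   has exactly one preimage. *)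
definition nevanlinna_T_inv :: "(complex \<Rightarrow> complex) \<Rightarrow> real \<Rightarrow> real" where
  "nevanlinna_T_inv g = inv_into {0<..} (nevanlinna_T g)"

(* For continuous g and r \<ge> 0 the supremum is attained. *)
definition max_modulus :: "(complex \<Rightarrow> complex) \<Rightarrow> real \<Rightarrow> real" where
  "max_modulus g r = (SUP z\<in>sphere 0 r. cmod (g z))"

definition iter_log :: "nat \<Rightarrow> real \<Rightarrow> real" where
  "iter_log k = ln ^^ k"

definition growth_quotient ::
  "nat \<Rightarrow> nat \<Rightarrow> (real \<Rightarrow> real) \<Rightarrow> (complex \<Rightarrow> complex) \<Rightarrow> (complex \<Rightarrow> complex) \<Rightarrow> real \<Rightarrow> real" where
  "growth_quotient p q \<phi> g f r =
     iter_log p (nevanlinna_T_inv g (nevanlinna_T f r)) / iter_log q (\<phi> r)"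

definition rel_order ::
  "nat \<Rightarrow> nat \<Rightarrow> (real \<Rightarrow> real) \<Rightarrow> (complex \<Rightarrow> complex) \<Rightarrow> (complex \<Rightarrow> complex) \<Rightarrow> ereal" where
  "rel_order p q \<phi> g f = Limsup at_top (\<lambda>r. ereal (growth_quotient p q \<phi> g f r))"

definition rel_lower_order ::
  "nat \<Rightarrow> nat \<Rightarrow> (real \<Rightarrow> real) \<Rightarrow> (complex \<Rightarrow> complex) \<Rightarrow> (complex \<Rightarrow> complex) \<Rightarrow> ereal" where
  "rel_lower_order p q \<phi> g f = Liminf at_top (\<lambda>r. ereal (growth_quotient p q \<phi> g f r))"

definition regular_growth ::
  "nat \<Rightarrow> nat \<Rightarrow> (real \<Rightarrow> real) \<Rightarrow> (complex \<Rightarrow> complex) \<Rightarrow> (complex \<Rightarrow> complex) \<Rightarrow> bool" where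
  "regular_growth p q \<phi> g f \<longleftrightarrow> rel_order p q \<phi> g f = rel_lower_order p q \<phi> g f"

definition property_A :: "(complex \<Rightarrow> complex) \<Rightarrow> bool" where
  "property_A g \<longleftrightarrow>
     (\<forall>\<sigma>>1. \<forall>\<^sub>F r in at_top. (max_modulus g r)\<^sup>2 \<le> max_modulus g (r powr \<sigma>))"

definition nonzero_finite :: "ereal \<Rightarrow> bool" where
  "nonzero_finite x \<longleftrightarrow> x \<noteq> 0 \<and> \<bar>x\<bar> \<noteq> \<infinity>"

end

(*
  For an entire g, log^+ |g| on a circle is approximated uniformly by Re P with P a polynomial
  (Stone-Weierstrass); by the maximum principle Re P majorizes log^+ |g| inside, which replaces the
  Poisson integral. The mean value property of Re P makes T_g increasing, and Harnack's inequality
  gives log M_g(r) <= 3 T_g(2r). Together with Property (A) this yields K T_g(r) <= T_g(r^sigma)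
  eventually, for every K and every sigma > 1.

  Jensen's formula gives T_{1/f} = T_f + O(1), so T_{f1 f2} <= T_{f1} + T_{f2} and
  T_{f1} <= T_{f1 f2} + T_{f2} + O(1). Applying T_g^{-1}, the factor lost in T_a + T_b + C <= 4 max
  is absorbed into an exponent sigma, which the logarithm turns into a factor sigma: the growth
  quotients satisfy Q_{f1 f2} <= sigma max(Q_{f1}, Q_{f2}) and Q_{f1} <= sigma max(Q_{f1 f2}, Q_{f2})
  eventually, for every sigma > 1. Both claims then follow, since lim inf max(Q, Q') is at most
  max(lim inf Q, lim sup Q') and lim sup Q' is the lower order of the factor of regular growth.
*)
theory Submission
  imports Defs "HOL-Real_Asymp.Real_Asymp"
begin

section \<open>Circle means and harmonic majorants\<close>

text \<open>A lower limit of a maximum can exceed the maximum of the two lower limits, since two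
  functions may be small at different radii. This is why one factor has to be of regular growth: its
  lim sup is then available under the name of its lower order. For equality the second comparison is
  read backwards: a lower order of f_i that exceeds the one of f_j can only be dominated by that of
  the product.

  T_g is only shown to be weakly increasing. This suffices because comparisons start from a strict
  inequality T_g(x) < T_g(y), which yields x <= y, and because any preimage may serve as the value
  of T_g^{-1}.

  Values at poles and removable singularities are arbitrary, so identities between meromorphic
  functions hold off a sparse set. A nonzero lower order excludes functions that are constant off
  such a set, zero included; hence T_f tends to infinity and division by a factor is legitimate.

  The delicate case of Jensen's formula is a zero or pole on the circle itself. It cannot be
  avoided, because the estimates are needed at every large radius.\<close>

lemma log_plus_eq_ln_max: "x \<ge> 0 \<Longrightarrow> log_plus x = ln (max 1 x)"
  by (cases "x = 0") (auto simp: log_plus_def max_def not_le dest: ln_ge_zero)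

lemma log_plus_nonneg: "log_plus x \<ge> 0"
  by (simp add: log_plus_def)

lemma ln_le_log_plus: "ln x \<le> log_plus x"
  by (simp add: log_plus_def)

lemma log_plus_mono: "0 \<le> x \<Longrightarrow> x \<le> y \<Longrightarrow> log_plus x \<le> log_plus y"
  by (simp add: log_plus_eq_ln_max)

definition circle_mean :: "(complex \<Rightarrow> real) \<Rightarrow> real \<Rightarrow> real" where
  "circle_mean u r = 1 / (2 * pi) * integral {0..2 * pi} (\<lambda>\<theta>. u (complex_of_real r * cis \<theta>))"

lemma nevanlinna_m_eq: "nevanlinna_m f = circle_mean (\<lambda>z. log_plus (cmod (f z)))"
  by (rule ext) (simp add: nevanlinna_m_def circle_mean_def)

text \<open>The Cauchy integral formula at the centre: under the parametrisation, dz / z becomes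
  \<open>\<i>\<close> times the angular measure, and taking imaginary parts removes the factor
  \<open>\<i>\<close>.\<close>

lemma has_integral_circle_Re:
  assumes "h holomorphic_on ball 0 S" "0 \<le> r" "r < S"
  shows "((\<lambda>\<theta>. Re (h (complex_of_real r * cis \<theta>))) has_integral 2 * pi * Re (h 0)) {0..2 * pi}"
proof (cases "r = 0")
  case True
  have "((\<lambda>_. Re (h 0)) has_integral (2 * pi - 0) *\<^sub>R Re (h 0)) {0..2 * pi}"
    using has_integral_const_real[of "Re (h 0)" 0 "2 * pi"] by simp
  then show ?thesis using True by simp
next
  case False
  then have r: "r > 0" using assms by simp
  have "((\<lambda>u. h u / (u - 0)) has_contour_integral 2 * of_real pi * \<i> * h 0) (circlepath 0 r)"
  proof (rule Cauchy_integral_circlepath)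
    show "continuous_on (cball 0 r) h"
      by (rule holomorphic_on_imp_continuous_on, rule holomorphic_on_subset[OF assms(1)])
         (use assms in auto)
    show "h holomorphic_on ball 0 r"
      by (rule holomorphic_on_subset[OF assms(1)]) (use assms in auto)
  qed (use r in auto)
  then have "((\<lambda>t. h (0 + r * cis t) / (0 + r * cis t - 0) * r * \<i> * cis t) has_integral
      2 * of_real pi * \<i> * h 0) {0..2 * pi}"
    unfolding circlepath_def
    by (subst (asm) has_contour_integral_part_circlepath_iff) simp_all
  then have "((\<lambda>t. h (r * cis t) * \<i>) has_integral 2 * of_real pi * \<i> * h 0) {0..2 * pi}"
    using r by (simp add: field_simps)
  then have "((\<lambda>t. Im (h (r * cis t) * \<i>)) has_integral Im (2 * of_real pi * \<i> * h 0)) {0..2 * pi}"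
    by (rule has_integral_linear[OF _ bounded_linear_Im, unfolded o_def])
  then show ?thesis by simp
qed

lemma circle_mean_Re:
  assumes "h holomorphic_on ball 0 S" "0 \<le> r" "r < S"
  shows "circle_mean (\<lambda>z. Re (h z)) r = Re (h 0)"
  unfolding circle_mean_def using has_integral_circle_Re[OF assms] by (simp add: integral_unique)

text \<open>A product of harmonic functions is not harmonic, but its restriction to a circle is
  again the restriction of the real part of a polynomial. This is the closure under products that
  Stone-Weierstrass asks for.\<close>

lemma Re_mult_Re_on_circle:
  assumes "R > 0"
  shows "\<exists>s. \<forall>z\<in>sphere 0 R. Re (poly p z) * Re (poly q z) = Re (poly s z)"
proof -
  define P where "P u \<longleftrightarrow> (\<exists>s. \<forall>z\<in>sphere 0 R. u z = Re (poly s z))" for u :: "complex \<Rightarrow> real"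
  have P_add: "P (\<lambda>z. u z + v z)" if "P u" "P v" for u v
  proof -
    from that obtain s t where "\<forall>z\<in>sphere 0 R. u z = Re (poly s z)" "\<forall>z\<in>sphere 0 R. v z = Re (poly t z)"
      unfolding P_def by blast
    then show ?thesis unfolding P_def by (intro exI[of _ "s + t"]) simp
  qed
  have P_sum: "P (\<lambda>z. \<Sum>i\<in>I. u i z)" if "finite I" "\<And>i. i \<in> I \<Longrightarrow> P (u i)" for u and I :: "nat set"
    using that
  proof (induction I rule: finite_induct)
    case empty
    then show ?case unfolding P_def by (intro exI[of _ 0]) simp
  next
    case (insert x F)
    then show ?case by (simp add: P_add)
  qed
  have Re_mult: "Re a * Re b = (Re (a * b) + Re (a * cnj b)) / 2" for a b
    by simp
  \<comment> \<open>On the circle \<open>z * cnj z\<close> is the constant \<open>R\<^sup>2\<close>, so \<open>z ^ m * cnj z ^ n\<close> is a multiple of \<open>z ^ (m - n)\<close>.\<close>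
  have P_le: "P (\<lambda>z. Re (a * z ^ m) * Re (b * z ^ n))" if "n \<le> m" for a b m n
    unfolding P_def
  proof (intro exI ballI)
    fix z :: complex assume "z \<in> sphere 0 R"
    then have z: "z * cnj z = of_real (R ^ 2)"
      by (simp add: complex_norm_square[symmetric])
    have zz: "z ^ m * cnj z ^ n = of_real (R ^ 2) ^ n * z ^ (m - n)"
    proof -
      have "z ^ m = z ^ n * z ^ (m - n)" using that by (simp add: power_add[symmetric])
      then show ?thesis by (simp only: z[symmetric] power_mult_distrib mult_ac)
    qed
    have "Re (a * z ^ m) * Re (b * z ^ n)
        = (Re (a * z ^ m * (b * z ^ n)) + Re (a * z ^ m * cnj (b * z ^ n))) / 2"
      by (rule Re_mult)
    also have "a * z ^ m * cnj (b * z ^ n) = a * cnj b * of_real (R ^ 2) ^ n * z ^ (m - n)"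
      using zz by (simp add: mult_ac)
    also have "a * z ^ m * (b * z ^ n) = a * b * z ^ (m + n)"
      by (simp add: power_add)
    finally show "Re (a * z ^ m) * Re (b * z ^ n) =
       Re (poly (monom (a * b / 2) (m + n) + monom (a * cnj b * of_real (R ^ 2) ^ n / 2) (m - n)) z)"
      by (simp add: poly_monom add_divide_distrib)
  qed
  have P_mono: "P (\<lambda>z. Re (a * z ^ m) * Re (b * z ^ n))" for a b m n
    using P_le[of n m a b] P_le[of m n b a] by (cases "n \<le> m") (simp_all add: mult.commute)
  have "P (\<lambda>z. \<Sum>i\<le>degree p. \<Sum>j\<le>degree q. Re (coeff p i * z ^ i) * Re (coeff q j * z ^ j))"
    by (intro P_sum P_mono) auto
  moreover have "Re (poly p z) * Re (poly q z)
      = (\<Sum>i\<le>degree p. \<Sum>j\<le>degree q. Re (coeff p i * z ^ i) * Re (coeff q j * z ^ j))" for z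
    by (simp only: poly_altdef Re_sum sum_product)
  ultimately show ?thesis unfolding P_def by simp
qed

text \<open>In effect approximation by trigonometric polynomials, phrased so that the approximant
  comes with a harmonic extension to the whole plane.\<close>

lemma approx_Re_poly_on_circle:
  fixes u :: "complex \<Rightarrow> real"
  assumes "R > 0" "continuous_on (sphere 0 R) u" "e > 0"
  obtains p where "\<And>z. z \<in> sphere 0 R \<Longrightarrow> \<bar>u z - Re (poly p z)\<bar> < e"
proof -
  define P where "P u \<longleftrightarrow> (\<exists>s. \<forall>z\<in>sphere 0 R. u z = Re (poly s z))" for u :: "complex \<Rightarrow> real"
  have "\<exists>g. P g \<and> (\<forall>z\<in>sphere 0 R. \<bar>u z - g z\<bar> < e)"
  proof (rule Stone_Weierstrass_HOL)
    show "P (\<lambda>x. c)" for c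
      unfolding P_def by (intro exI[of _ "[:of_real c:]"]) simp
    show "continuous_on (sphere 0 R) f" if f: "P f" for f
    proof -
      from f obtain s where s: "\<forall>z\<in>sphere 0 R. f z = Re (poly s z)" unfolding P_def by blast
      have "continuous_on (sphere 0 R) (\<lambda>z. Re (poly s z))" by (intro continuous_intros)
      then show ?thesis using s by (subst continuous_on_cong[OF refl]) auto
    qed
    show "P (\<lambda>x. f x + g x)" if "P f \<and> P g" for f g
    proof -
      from that obtain s t where "\<forall>z\<in>sphere 0 R. f z = Re (poly s z)" "\<forall>z\<in>sphere 0 R. g z = Re (poly t z)"
        unfolding P_def by blast
      then show ?thesis unfolding P_def by (intro exI[of _ "s + t"]) simp
    qed
    show "P (\<lambda>x. f x * g x)" if "P f \<and> P g" for f g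
    proof -
      from that obtain s t where st: "\<forall>z\<in>sphere 0 R. f z = Re (poly s z)" "\<forall>z\<in>sphere 0 R. g z = Re (poly t z)"
        unfolding P_def by blast
      then show ?thesis unfolding P_def using Re_mult_Re_on_circle[OF assms(1), of s t] by simp
    qed
    show "\<exists>f. P f \<and> f x \<noteq> f y" if "x \<in> sphere 0 R \<and> y \<in> sphere 0 R \<and> x \<noteq> y" for x y
    proof -
      have "P Re" unfolding P_def by (intro exI[of _ "[:0, 1:]"]) simp
      moreover have "P Im" unfolding P_def by (intro exI[of _ "[:0, -\<i>:]"]) simp
      ultimately show ?thesis using that by (metis complex_eqI)
    qed
  qed (use assms in auto)
  then show ?thesis using that unfolding P_def by metis
qed

lemma harmonic_majorant:
  assumes g: "g holomorphic_on UNIV" and R: "R > 0" and e: "e > 0"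
  obtains P where "P holomorphic_on UNIV"
    and "\<And>z. cmod z \<le> R \<Longrightarrow> log_plus (cmod (g z)) \<le> Re (P z)"
    and "\<And>z. cmod z \<le> R \<Longrightarrow> 0 < Re (P z)"
    and "\<And>z. cmod z = R \<Longrightarrow> Re (P z) \<le> log_plus (cmod (g z)) + e"
proof -
  have contg: "continuous_on A g" for A
    using g holomorphic_on_imp_continuous_on continuous_on_subset by blast
  \<comment> \<open>Raising the target by \<open>e / 2\<close> and approximating within
    \<open>e / 4\<close> keeps the polynomial at least \<open>e / 4\<close> and less than
    \<open>e\<close> above \<open>log_plus\<close> on the circle.\<close>
  have "continuous_on (sphere 0 R) (\<lambda>z. log_plus (cmod (g z)) + e / 2)"
    unfolding log_plus_eq_ln_max[OF norm_ge_zero]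
    by (intro continuous_intros contg) (smt (verit) max.cobounded1)
  from approx_Re_poly_on_circle[OF R this, of "e / 4"] e obtain p where
    p: "\<And>z. z \<in> sphere 0 R \<Longrightarrow> \<bar>log_plus (cmod (g z)) + e / 2 - Re (poly p z)\<bar> < e / 4"
    by auto
  have p': "log_plus (cmod (g z)) + e / 4 \<le> Re (poly p z)"
           "Re (poly p z) \<le> log_plus (cmod (g z)) + e" if "cmod z = R" for z
    using p[of z, unfolded abs_less_iff] that e by simp_all
  \<comment> \<open>The modulus of \<open>h * exp (- p)\<close> is |h| exp (- Re p), so the maximum
    modulus principle compares ln |h| with Re p. The choice \<open>h = 1\<close> gives positivity
    inside, \<open>h = g\<close> gives the majorization.\<close>
  have exp_bound: "cmod (h z * exp (- poly p z)) \<le> B"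
    if h: "h holomorphic_on UNIV" and le: "\<And>w. cmod w = R \<Longrightarrow> cmod (h w * exp (- poly p w)) \<le> B"
      and z: "cmod z \<le> R" for h B z
  proof (rule maximum_modulus_frontier[where S = "cball 0 R" and f = "\<lambda>w. h w * exp (- poly p w)"])
    have hol: "(\<lambda>w. h w * exp (- poly p w)) holomorphic_on UNIV"
      by (intro holomorphic_intros h)
    then show "(\<lambda>w. h w * exp (- poly p w)) holomorphic_on interior (cball 0 R)"
      by (rule holomorphic_on_subset) auto
    show "continuous_on (closure (cball 0 R)) (\<lambda>w. h w * exp (- poly p w))"
      using hol holomorphic_on_imp_continuous_on continuous_on_subset by blast
  qed (use le z R in \<open>auto simp: frontier_cball\<close>)
  show ?thesis
  proof
    show "poly p holomorphic_on UNIV" by (intro holomorphic_intros)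
    show pos: "0 < Re (poly p z)" if "cmod z \<le> R" for z
    proof -
      have "cmod (1 * exp (- poly p z)) \<le> exp (- e / 4)"
      proof (rule exp_bound[OF _ _ that])
        fix w assume "cmod w = R"
        then have "Re (poly p w) \<ge> e / 4"
          using p'(1)[of w] log_plus_nonneg[of "cmod (g w)"] by simp
        then show "cmod (1 * exp (- poly p w)) \<le> exp (- e / 4)" by simp
      qed auto
      then show ?thesis using e by simp
    qed
    show "log_plus (cmod (g z)) \<le> Re (poly p z)" if z: "cmod z \<le> R" for z
    proof -
      have "cmod (g z * exp (- poly p z)) \<le> 1"
      proof (rule exp_bound[OF g _ z])
        fix w assume w: "cmod w = R"
        have "cmod (g w) \<le> exp (Re (poly p w))"
        proof (cases "g w = 0")
          case False
          have "ln (cmod (g w)) \<le> Re (poly p w)"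
            using p'(1)[OF w] ln_le_log_plus[of "cmod (g w)"] e by simp
          then show ?thesis using False by (metis exp_le_cancel_iff exp_ln zero_less_norm_iff)
        qed simp
        then show "cmod (g w * exp (- poly p w)) \<le> 1"
          by (simp add: norm_mult norm_divide exp_minus divide_simps)
      qed
      then have "cmod (g z) \<le> exp (Re (poly p z))"
        by (simp add: norm_mult norm_divide exp_minus divide_simps)
      then have "max 1 (cmod (g z)) \<le> exp (Re (poly p z))" using pos[OF z] by simp
      then have "ln (max 1 (cmod (g z))) \<le> Re (poly p z)"
        by (metis ln_exp ln_mono less_max_iff_disj zero_less_one)
      then show ?thesis by (simp add: log_plus_eq_ln_max)
    qed
    show "Re (poly p z) \<le> log_plus (cmod (g z)) + e" if "cmod z = R" for z
      using p'(2)[OF that] .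
  qed
qed

lemma harnack_half_disc:
  assumes P: "P holomorphic_on ball 0 R" and R: "R > 0"
    and pos: "\<And>z. cmod z < R \<Longrightarrow> 0 < Re (P z)" and z: "cmod z \<le> R / 2"
  shows "Re (P z) \<le> 3 * Re (P 0)"
proof -
  \<comment> \<open>the Cayley transform of the right half-plane sending \<open>P 0\<close> to \<open>0\<close>, to which the Schwarz lemma applies\<close>
  define f where "f w = (P (of_real R * w) - P 0) / (P (of_real R * w) + cnj (P 0))" for w
  have in_ball: "cmod (of_real R * w) < R" if "cmod w < 1" for w
    using that R by (simp add: norm_mult)
  have den: "P (of_real R * w) + cnj (P 0) \<noteq> 0" if "cmod w < 1" for w
  proof
    assume "P (of_real R * w) + cnj (P 0) = 0"
    then have "Re (P (of_real R * w)) + Re (P 0) = 0" by (metis plus_complex.sel(1) complex_cnj(1) zero_complex.sel(1) complex.sel(1) cnj.sel(1))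
    then show False using pos[OF in_ball[OF that]] pos[of 0] R by simp
  qed
  have hol: "f holomorphic_on ball 0 1"
  proof -
    have "(\<lambda>w. P (of_real R * w)) holomorphic_on ball 0 1"
      by (rule holomorphic_on_compose_gen[unfolded o_def, OF _ P]) (auto intro!: holomorphic_intros in_ball)
    then show ?thesis unfolding f_def using den by (intro holomorphic_intros) auto
  qed
  have lt: "cmod (f w) < 1" if "cmod w < 1" for w
  proof -
    define x where "x = P (of_real R * w)"
    have x: "Re x > 0" unfolding x_def by (rule pos[OF in_ball[OF that]])
    have p0: "Re (P 0) > 0" using pos[of 0] R by simp
    \<comment> \<open>A point of the right half-plane is closer to \<open>P 0\<close> than to the
      mirror image \<open>- cnj (P 0)\<close>.\<close>
    have "(cmod (x + cnj (P 0)))\<^sup>2 - (cmod (x - P 0))\<^sup>2 = 4 * Re x * Re (P 0)"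
      unfolding cmod_power2 by (simp add: power2_eq_square algebra_simps)
    also have "\<dots> > 0" using x p0 by simp
    finally have "cmod (x - P 0) < cmod (x + cnj (P 0))"
      by (simp add: power2_less_imp_less)
    then show ?thesis using den[OF that] unfolding f_def x_def[symmetric]
      by (simp add: norm_divide)
  qed
  define w where "w = z / of_real R"
  have w: "cmod w \<le> 1 / 2" using z R by (simp add: w_def norm_divide field_simps)
  have "cmod (f w) \<le> cmod w"
    by (rule Schwarz_Lemma(1)[OF hol _ lt]) (use w in \<open>auto simp: f_def\<close>)
  then have "cmod (f w) \<le> 1 / 2" using w by simp
  define x where "x = P z"
  have Rw: "of_real R * w = z" using R by (simp add: w_def)
  have "2 * cmod (x - P 0) \<le> cmod (x + cnj (P 0))"
    using \<open>cmod (f w) \<le> 1 / 2\<close> den[of w] w unfolding f_def Rw x_def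
    by (simp add: norm_divide field_simps)
  then have "(2 * cmod (x - P 0))\<^sup>2 \<le> (cmod (x + cnj (P 0)))\<^sup>2"
    by (intro power_mono) auto
  then have "4 * ((Re x - Re (P 0))\<^sup>2 + (Im x - Im (P 0))\<^sup>2)
      \<le> (Re x + Re (P 0))\<^sup>2 + (Im x - Im (P 0))\<^sup>2"
    unfolding power_mult_distrib cmod_power2 by simp
  then have "(2 * (Re x - Re (P 0)))\<^sup>2 \<le> (Re x + Re (P 0))\<^sup>2"
    unfolding power_mult_distrib distrib_left using zero_le_power2[of "Im x - Im (P 0)"]
    by (simp, linarith)
  moreover have "Re x + Re (P 0) \<ge> 0"
    using pos[of z] pos[of 0] z R by (simp add: x_def)
  ultimately have "2 * (Re x - Re (P 0)) \<le> Re x + Re (P 0)"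
    by (rule power2_le_imp_le)
  then show ?thesis by (simp add: x_def)
qed

lemma continuous_log_plus_cmod:
  assumes "continuous_on A g"
  shows "continuous_on A (\<lambda>z. log_plus (cmod (g z)))"
  unfolding log_plus_eq_ln_max[OF norm_ge_zero]
  by (intro continuous_intros assms) (smt (verit) max.cobounded1)

lemma circle_mean_mono:
  assumes "\<And>z. cmod z = r \<Longrightarrow> u z \<le> v z" and "r \<ge> 0"
    and "(\<lambda>\<theta>. u (complex_of_real r * cis \<theta>)) integrable_on {0..2 * pi}"
    and "(\<lambda>\<theta>. v (complex_of_real r * cis \<theta>)) integrable_on {0..2 * pi}"
  shows "circle_mean u r \<le> circle_mean v r"
  unfolding circle_mean_def
  by (intro mult_left_mono integral_le assms(3,4)) (auto simp: assms norm_mult)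

lemma integrable_circle_continuous:
  fixes u :: "complex \<Rightarrow> real"
  assumes "continuous_on (sphere 0 r) u" "r \<ge> 0"
  shows "(\<lambda>\<theta>. u (complex_of_real r * cis \<theta>)) integrable_on {0..2 * pi}"
  by (intro integrable_continuous_real continuous_on_compose2[OF assms(1)] continuous_intros)
     (use assms(2) in \<open>auto simp: norm_mult\<close>)

section \<open>The proximity function of an entire function\<close>

context
  fixes g :: "complex \<Rightarrow> complex"
  assumes g: "g holomorphic_on UNIV"
begin

lemma entire_continuous: "continuous_on A g"
  using g holomorphic_on_imp_continuous_on continuous_on_subset by blast

lemma entire_log_plus_integrable:
  "r \<ge> 0 \<Longrightarrow> (\<lambda>\<theta>. log_plus (cmod (g (complex_of_real r * cis \<theta>)))) integrable_on {0..2 * pi}"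
  by (rule integrable_circle_continuous) (intro continuous_log_plus_cmod entire_continuous)

text \<open>The value at the centre is the link between a majorant and the characteristic: the mean
  value property turns the bound on the circle into a bound for \<open>Re (P 0)\<close>.\<close>

lemma majorant_at_0_le:
  assumes "P holomorphic_on UNIV" "R > 0"
    and "\<And>z. cmod z = R \<Longrightarrow> Re (P z) \<le> log_plus (cmod (g z)) + e"
  shows "Re (P 0) \<le> nevanlinna_m g R + e"
proof -
  have hol: "P holomorphic_on ball 0 S" for S
    using assms(1) holomorphic_on_subset by blast
  have "Re (P 0) = circle_mean (\<lambda>z. Re (P z)) R"
    using circle_mean_Re[OF hol, of R "R + 1"] assms by simp
  also have "\<dots> \<le> circle_mean (\<lambda>z. log_plus (cmod (g z)) + e) R"
  proof (rule circle_mean_mono[OF assms(3)])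
    show "(\<lambda>\<theta>. Re (P (complex_of_real R * cis \<theta>))) integrable_on {0..2 * pi}"
      using has_integral_circle_Re[OF hol, of R "R + 1"] assms by (auto simp: integrable_on_def)
    show "(\<lambda>\<theta>. log_plus (cmod (g (complex_of_real R * cis \<theta>))) + e) integrable_on {0..2 * pi}"
      using assms by (intro integrable_add entire_log_plus_integrable) auto
  qed (use assms in auto)
  also have "\<dots> = nevanlinna_m g R + e"
    unfolding nevanlinna_m_eq circle_mean_def
    using assms entire_log_plus_integrable[of R] by (subst integral_add) (auto simp: field_simps)
  finally show ?thesis .
qed

lemma nevanlinna_m_mono:
  assumes "0 < r" "r \<le> R"
  shows "nevanlinna_m g r \<le> nevanlinna_m g R"
proof (rule field_le_epsilon)
  fix e :: real assume "e > 0"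
  then obtain P where P: "P holomorphic_on UNIV"
    "\<And>z. cmod z \<le> R \<Longrightarrow> log_plus (cmod (g z)) \<le> Re (P z)"
    "\<And>z. cmod z = R \<Longrightarrow> Re (P z) \<le> log_plus (cmod (g z)) + e"
    using harmonic_majorant[OF g, of R e] assms by (metis less_le_trans)
  have hol: "P holomorphic_on ball 0 S" for S
    using P(1) holomorphic_on_subset by blast
  have "nevanlinna_m g r \<le> circle_mean (\<lambda>z. Re (P z)) r"
    unfolding nevanlinna_m_eq
  proof (rule circle_mean_mono)
    show "(\<lambda>\<theta>. Re (P (complex_of_real r * cis \<theta>))) integrable_on {0..2 * pi}"
      using has_integral_circle_Re[OF hol, of r "r + 1"] assms by (auto simp: integrable_on_def)
  qed (use assms P entire_log_plus_integrable in auto)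
  also have "\<dots> = Re (P 0)"
    using circle_mean_Re[OF hol, of r "r + 1"] assms by simp
  also have "\<dots> \<le> nevanlinna_m g R + e"
    using majorant_at_0_le[OF P(1) _ P(3)] assms by auto
  finally show "nevanlinna_m g r \<le> nevanlinna_m g R + e" .
qed

lemma log_plus_le_nevanlinna_m:
  assumes "r > 0" "cmod z \<le> r"
  shows "log_plus (cmod (g z)) \<le> 3 * nevanlinna_m g (2 * r)"
proof (rule field_le_epsilon)
  fix e :: real assume "e > 0"
  then obtain P where P: "P holomorphic_on UNIV"
    "\<And>z. cmod z \<le> 2 * r \<Longrightarrow> log_plus (cmod (g z)) \<le> Re (P z)"
    "\<And>z. cmod z \<le> 2 * r \<Longrightarrow> 0 < Re (P z)"
    "\<And>z. cmod z = 2 * r \<Longrightarrow> Re (P z) \<le> log_plus (cmod (g z)) + e / 3"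
    using harmonic_majorant[OF g, of "2 * r" "e / 3"] assms by auto
  have "log_plus (cmod (g z)) \<le> Re (P z)" using P(2)[of z] assms by simp
  also have "\<dots> \<le> 3 * Re (P 0)"
    by (rule harnack_half_disc[where R = "2 * r"])
       (use P assms in \<open>auto intro: holomorphic_on_subset\<close>)
  also have "\<dots> \<le> 3 * (nevanlinna_m g (2 * r) + e / 3)"
    using majorant_at_0_le[OF P(1), of "2 * r" "e / 3"] P(4) assms by simp
  finally show "log_plus (cmod (g z)) \<le> 3 * nevanlinna_m g (2 * r) + e" by simp
qed

text \<open>Serves the intermediate value theorem behind the inverse of the characteristic.\<close>

lemma nevanlinna_m_continuous: "continuous_on {0<..} (nevanlinna_m g)"
proof -
  have "continuous_on ({0<..} \<times> cbox 0 (2 * pi))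
     (\<lambda>(r, \<theta>). log_plus (cmod (g (complex_of_real r * cis \<theta>))))"
    unfolding split_beta
    by (intro continuous_log_plus_cmod continuous_on_compose2[OF entire_continuous[of UNIV]] continuous_intros)
       auto
  from integral_continuous_on_param[OF this]
  have "continuous_on {0<..} (\<lambda>r. 1 / (2 * pi) * integral (cbox 0 (2 * pi)) (\<lambda>\<theta>. log_plus (cmod (g (complex_of_real r * cis \<theta>)))))"
    by (intro continuous_intros)
  then show ?thesis by (simp add: nevanlinna_m_def[abs_def])
qed

text \<open>By Liouville \<open>g\<close> is large at some point, which makes
  \<open>nevanlinna_m g\<close> large at one radius; monotonicity carries this to all larger radii.
  The 3 in the exponent cancels the Harnack constant.\<close>

lemma nevanlinna_m_at_top:
  assumes "\<not> g constant_on UNIV"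
  shows "filterlim (nevanlinna_m g) at_top at_top"
  unfolding filterlim_at_top
proof
  fix B :: real
  have "\<not> bounded (range g)"
    using Liouville_theorem[OF g] assms by (auto simp: constant_on_def)
  then obtain z where z: "cmod (g z) > exp (3 * \<bar>B\<bar>)"
    unfolding bounded_iff by (metis not_le rangeE)
  define r where "r = max 1 (cmod z)"
  have "3 * \<bar>B\<bar> \<le> ln (cmod (g z))"
    using z by (metis exp_gt_zero less_trans less_imp_le ln_exp ln_le_cancel_iff)
  also have "\<dots> \<le> log_plus (cmod (g z))" by (rule ln_le_log_plus)
  also have "\<dots> \<le> 3 * nevanlinna_m g (2 * r)"
    by (rule log_plus_le_nevanlinna_m) (auto simp: r_def)
  finally have "B \<le> nevanlinna_m g (2 * r)" by simp
  then show "\<forall>\<^sub>F x in at_top. B \<le> nevanlinna_m g x"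
    unfolding eventually_at_top_linorder
    by (intro exI[of _ "2 * r"]) (use nevanlinna_m_mono[of "2 * r"] in \<open>force simp: r_def\<close>)
qed

lemma nevanlinna_T_entire: "nevanlinna_T g r = nevanlinna_m g r"
proof -
  have "\<not> is_pole g z" for z
    using g analytic_at_imp_no_pole holomorphic_on_imp_analytic_at by blast
  then show ?thesis by (simp add: nevanlinna_T_def nevanlinna_N_def pole_count_def)
qed

end

section \<open>Logarithmic means over circles\<close>

text \<open>Two angles with the same image differ by a multiple of 2 pi, and within
  \<open>{0..2 * pi}\<close> only the multiples -1, 0 and 1 are possible. Finitely many exceptional
  points on a circle therefore never affect an integral.\<close>

lemma finite_circle_preimage:
  assumes "finite S" "r > 0"
  shows "finite {\<theta>\<in>{0..2 * pi}. complex_of_real r * cis \<theta> \<in> S}"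
proof -
  have "finite {\<theta>\<in>{0..2 * pi}. complex_of_real r * cis \<theta> = a}" for a
  proof (cases "\<exists>\<theta>0\<in>{0..2 * pi}. complex_of_real r * cis \<theta>0 = a")
    case True
    then obtain \<theta>0 where \<theta>0: "\<theta>0 \<in> {0..2 * pi}" "complex_of_real r * cis \<theta>0 = a" by blast
    have "{\<theta>\<in>{0..2 * pi}. complex_of_real r * cis \<theta> = a} \<subseteq> {\<theta>0 - 2 * pi, \<theta>0, \<theta>0 + 2 * pi}"
    proof
      fix \<theta> assume \<theta>: "\<theta> \<in> {\<theta>\<in>{0..2 * pi}. complex_of_real r * cis \<theta> = a}"
      then have "cis \<theta> = cis \<theta>0" using \<theta>0 assms by auto
      then have "sin \<theta> = sin \<theta>0 \<and> cos \<theta> = cos \<theta>0" by (simp add: complex_eq_iff)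
      then obtain n :: int where n: "\<theta> = \<theta>0 + 2 * pi * n" using sin_cos_eq_iff by blast
      have "\<bar>\<theta> - \<theta>0\<bar> \<le> 2 * pi"
        using \<theta> \<theta>0(1) by auto
      moreover have "\<theta> - \<theta>0 = 2 * pi * real_of_int n" using n by simp
      ultimately have "\<bar>2 * pi * real_of_int n\<bar> \<le> 2 * pi" by metis
      then have "2 * pi * \<bar>real_of_int n\<bar> \<le> 2 * pi * 1" by (simp add: abs_mult)
      then have "\<bar>real_of_int n\<bar> \<le> 1" by (subst (asm) mult_le_cancel_left_pos) auto
      then have "n = -1 \<or> n = 0 \<or> n = 1" by linarith
      then show "\<theta> \<in> {\<theta>0 - 2 * pi, \<theta>0, \<theta>0 + 2 * pi}" using n by auto
    qed
    then show ?thesis using finite_subset by blast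
  qed (simp add: Collect_conv_if2 cong: conj_cong)
  then have "finite (\<Union>a\<in>S. {\<theta>\<in>{0..2 * pi}. complex_of_real r * cis \<theta> = a})"
    using assms by blast
  then show ?thesis by (rule rev_finite_subset) auto
qed

text \<open>A closed disc contains only finitely many points of a sparse set. The equivalence form
  also transfers failure of integrability, so the means agree without any integrability
  assumption.\<close>

lemma has_integral_circle_cong:
  fixes u v :: "complex \<Rightarrow> real"
  assumes "eventually (\<lambda>z. u z = v z) (cosparse UNIV)" "r > 0"
  shows "((\<lambda>\<theta>. u (complex_of_real r * cis \<theta>)) has_integral I) {0..2 * pi} \<longleftrightarrow>
         ((\<lambda>\<theta>. v (complex_of_real r * cis \<theta>)) has_integral I) {0..2 * pi}"
proof (rule has_integral_spike_finite_eq)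
  have "{z. u z \<noteq> v z} sparse_in cball 0 r"
    using assms(1) unfolding eventually_cosparse by (rule sparse_in_subset) auto
  then have "finite (cball 0 r \<inter> {z. u z \<noteq> v z})"
    by (rule sparse_in_compact_finite) auto
  then show "finite {\<theta>\<in>{0..2 * pi}. complex_of_real r * cis \<theta> \<in> cball 0 r \<inter> {z. u z \<noteq> v z}}"
    using assms(2) by (rule finite_circle_preimage)
qed (use assms(2) in \<open>auto simp: norm_mult\<close>)

lemma circle_mean_cong:
  assumes "eventually (\<lambda>z. u z = v z) (cosparse UNIV)" "r > 0"
  shows "circle_mean u r = circle_mean v r"
proof -
  have "integral {0..2 * pi} (\<lambda>\<theta>. u (complex_of_real r * cis \<theta>))
      = integral {0..2 * pi} (\<lambda>\<theta>. v (complex_of_real r * cis \<theta>))"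
    unfolding integral_def integrable_on_def has_integral_circle_cong[OF assms] ..
  then show ?thesis by (simp add: circle_mean_def)
qed

text \<open>A zero-free holomorphic function on a disc has a holomorphic logarithm, and
  \<open>ln (cmod (h z))\<close> is its real part; so this is the mean value property.\<close>

lemma has_integral_circle_ln_nonvanishing:
  assumes "h holomorphic_on ball 0 S" "\<And>z. z \<in> ball 0 S \<Longrightarrow> h z \<noteq> 0" "0 \<le> r" "r < S"
  shows "((\<lambda>\<theta>. ln (cmod (h (complex_of_real r * cis \<theta>)))) has_integral 2 * pi * ln (cmod (h 0))) {0..2 * pi}"
proof -
  have S: "S > 0" using assms by simp
  obtain L where L: "L holomorphic_on ball 0 S" "\<And>z. z \<in> ball 0 S \<Longrightarrow> exp (L z) = h z"
    using holomorphic_logarithm_exists[OF convex_ball open_ball assms(1,2), of 0] S by auto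
  have eq: "ln (cmod (h z)) = Re (L z)" if "z \<in> ball 0 S" for z
    using L(2)[OF that, symmetric] by simp
  have "((\<lambda>\<theta>. Re (L (complex_of_real r * cis \<theta>))) has_integral 2 * pi * Re (L 0)) {0..2 * pi}"
    by (rule has_integral_circle_Re[OF L(1)]) (use assms in auto)
  then show ?thesis
    using eq S assms by (simp add: norm_mult)
qed

text \<open>The zero at \<open>a\<close> lies inside the circle. Reflection removes it: on the
  circle |z - a| equals |R - cnj a cis \<theta>|, and the reflected factor has no zero in a
  neighbourhood of the closed unit disc.\<close>

lemma has_integral_circle_ln_dist_inside:
  assumes R: "R > 0" and a: "cmod a < R"
  shows "((\<lambda>\<theta>. ln (cmod (complex_of_real R * cis \<theta> - a))) has_integral 2 * pi * ln R) {0..2 * pi}"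
proof -
  \<comment> \<open>R / |a| is the modulus of the zero of the reflected factor. For
    \<open>a = 0\<close> that factor is constant and any radius above 1 will do.\<close>
  define S where "S = (if a = 0 then 2 else R / cmod a)"
  have S: "S > 1" using a R by (auto simp: S_def)
  have nz: "of_real R - cnj a * z \<noteq> 0" if "z \<in> ball 0 S" for z
  proof
    assume "of_real R - cnj a * z = 0"
    then have "cmod (of_real R) = cmod (cnj a * z)" by simp
    then have "R = cmod a * cmod z" using R by (simp add: norm_mult)
    moreover from this have "a \<noteq> 0" using R by auto
    ultimately show False using that by (auto simp: S_def)
  qed
  have "((\<lambda>\<theta>. ln (cmod (of_real R - cnj a * (complex_of_real 1 * cis \<theta>)))) has_integral
      2 * pi * ln (cmod (of_real R - cnj a * 0))) {0..2 * pi}"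
    by (rule has_integral_circle_ln_nonvanishing[where S = S])
       (use S nz in \<open>auto intro!: holomorphic_intros\<close>)
  moreover have "cmod (of_real R - cnj a * (complex_of_real 1 * cis \<theta>)) = cmod (complex_of_real R * cis \<theta> - a)" for \<theta>
  proof -
    have "cmod (of_real R - cnj a * (complex_of_real 1 * cis \<theta>)) = cmod (cnj (of_real R - cnj a * (complex_of_real 1 * cis \<theta>)))"
      by (simp only: complex_mod_cnj)
    also have "\<dots> = cmod (cis \<theta> * (of_real R - a * cis (- \<theta>)))"
      by (simp add: norm_mult cis_cnj)
    also have "cis \<theta> * (of_real R - a * cis (- \<theta>)) = complex_of_real R * cis \<theta> - a"
      by (simp add: algebra_simps cis_mult)
    finally show ?thesis .
  qed
  ultimately show ?thesis using a R by simp
qed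

lemma has_integral_circle_ln_dist:
  assumes R: "R > 0"
  shows "((\<lambda>\<theta>. ln (cmod (complex_of_real R * cis \<theta> - a))) has_integral 2 * pi * ln (max R (cmod a))) {0..2 * pi}"
proof -
  consider "cmod a > R" | "cmod a < R" | "cmod a = R" by linarith
  then show ?thesis
  proof cases
    case 1
    have "((\<lambda>\<theta>. ln (cmod (complex_of_real R * cis \<theta> - a))) has_integral 2 * pi * ln (cmod (0 - a))) {0..2 * pi}"
      by (rule has_integral_circle_ln_nonvanishing[where S = "cmod a"])
         (use 1 R in \<open>auto intro!: holomorphic_intros\<close>)
    then show ?thesis using 1 by simp
  next
    case 2
    then show ?thesis using has_integral_circle_ln_dist_inside[OF R] by simp
  next
    case 3
    \<comment> \<open>Replace \<open>a\<close> by \<open>t a\<close> with \<open>t\<close> increasing to \<open>1\<close>. Since \<open>\<bar>z - t a\<bar>\<^sup>2 / t = R\<^sup>2 (t + 1 / t) - 2 Re (z cnj a)\<close> for \<open>\<bar>z\<bar> = \<bar>a\<bar> = R\<close>,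
      the normalized logarithms decrease to the integrand, and monotone convergence applies.\<close>
    define t where "t k = 1 - 1 / (real k + 2)" for k
    have t: "0 < t k" "t k < 1" "t k \<le> t (Suc k)" for k
      by (auto simp: t_def field_simps)
    have t_lim: "t \<longlonglongrightarrow> 1" unfolding t_def by real_asymp
    define s where "s k = t k + 1 / t k" for k
    have s_lim: "s \<longlonglongrightarrow> 2" unfolding s_def using tendsto_add[OF t_lim tendsto_divide[OF tendsto_const[of 1] t_lim]] by simp
    have s_dec: "s (Suc k) \<le> s k" for k
    proof -
      have "s k - s (Suc k) = (t (Suc k) - t k) * (1 / (t k * t (Suc k)) - 1)"
        using t(1)[of k] t(1)[of "Suc k"] by (simp add: s_def field_simps)
      moreover have "t k * t (Suc k) \<le> 1"
        using t[of k] t[of "Suc k"] by (simp add: mult_le_one less_imp_le)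
      ultimately show ?thesis
        using t[of k] t(1)[of "Suc k"] by (smt (verit) mult_nonneg_nonneg mult_pos_pos le_divide_eq_1_pos)
    qed
    have s2: "s k \<ge> 2" for k
      using decseq_ge[OF _ s_lim, of k] s_dec by (simp add: decseq_Suc_iff)
    define Z where "Z \<theta> = complex_of_real R * cis \<theta>" for \<theta>
    have cmodZ: "cmod (Z \<theta>) = R" for \<theta> using R by (simp add: Z_def norm_mult)
    have sq: "(cmod (Z \<theta> - of_real c * a))\<^sup>2 = R\<^sup>2 * (1 + c\<^sup>2) - 2 * c * Re (Z \<theta> * cnj a)" for c \<theta>
    proof -
      have "(cmod (Z \<theta> - of_real c * a))\<^sup>2 = (cmod (Z \<theta>))\<^sup>2 + c\<^sup>2 * (cmod a)\<^sup>2 - 2 * c * Re (Z \<theta> * cnj a)"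
        unfolding cmod_power2 by (simp add: power2_eq_square algebra_simps)
      then show ?thesis using cmodZ 3 by (simp add: algebra_simps)
    qed
    have pos: "R\<^sup>2 * s k - 2 * Re (Z \<theta> * cnj a) > 0" if "Z \<theta> \<noteq> a" for k \<theta>
    proof -
      have "0 < (cmod (Z \<theta> - of_real 1 * a))\<^sup>2" using that by simp
      also have "\<dots> = R\<^sup>2 * 2 - 2 * Re (Z \<theta> * cnj a)" using sq[of \<theta> 1] by simp
      also have "R\<^sup>2 * 2 \<le> R\<^sup>2 * s k" using s2 by (intro mult_left_mono) auto
      finally show ?thesis by simp
    qed
    \<comment> \<open>The value 0 where \<open>Z \<theta> = a\<close> agrees with
      \<open>ln 0 = 0\<close> in the limit function, so the convergence is monotone at every
      angle.\<close>
    define f where "f k \<theta> = (if Z \<theta> = a then 0 else ln (R\<^sup>2 * s k - 2 * Re (Z \<theta> * cnj a)) / 2)" for k \<theta>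
    have ln_sq: "ln (x\<^sup>2) / 2 = ln x" if "x > 0" for x :: real
      using that by (simp add: ln_realpow)
    \<comment> \<open>Up to the constant \<open>ln (t k) / 2\<close>, which tends to 0, this is the
      logarithmic distance to a point inside the circle, whose integral is already known.\<close>
    have f_eq: "f k \<theta> = ln (cmod (Z \<theta> - of_real (t k) * a)) - ln (t k) / 2" if "Z \<theta> \<noteq> a" for k \<theta>
    proof -
      have "cmod (of_real (t k) * a) < R" using t[of k] 3 R by (simp add: norm_mult)
      then have nz: "cmod (Z \<theta> - of_real (t k) * a) > 0" using cmodZ[of \<theta>] by auto
      have "R\<^sup>2 * s k - 2 * Re (Z \<theta> * cnj a) = (cmod (Z \<theta> - of_real (t k) * a))\<^sup>2 / t k"
        unfolding sq s_def using t(1)[of k] by (simp add: field_simps power2_eq_square)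
      then show ?thesis
        using that nz t(1)[of k] by (simp add: f_def ln_div diff_divide_distrib ln_sq)
    qed
    have bad: "finite {\<theta>\<in>{0..2 * pi}. Z \<theta> = a}"
      using finite_circle_preimage[of "{a}" R] R by (simp add: Z_def)
    have f_int: "(f k has_integral (2 * pi * ln R - pi * ln (t k))) {0..2 * pi}" for k
    proof (rule has_integral_spike_finite[OF bad])
      have "((\<lambda>\<theta>. ln (cmod (Z \<theta> - of_real (t k) * a))) has_integral 2 * pi * ln R) {0..2 * pi}"
        unfolding Z_def using t[of k] 3 R
        by (intro has_integral_circle_ln_dist_inside) (auto simp: norm_mult)
      from has_integral_diff[OF this has_integral_const_real[of "ln (t k) / 2" 0 "2 * pi"]]
      show "((\<lambda>\<theta>. ln (cmod (Z \<theta> - of_real (t k) * a)) - ln (t k) / 2) has_integral 2 * pi * ln R - pi * ln (t k)) {0..2 * pi}"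
        by simp
    qed (use f_eq in auto)
    have int_lim: "(\<lambda>k. 2 * pi * ln R - pi * ln (t k)) \<longlonglongrightarrow> 2 * pi * ln R - pi * ln 1"
      by (intro tendsto_intros t_lim) auto
    define g where "g \<theta> = ln (cmod (Z \<theta> - a))" for \<theta>
    have "g integrable_on {0..2 * pi} \<and> (\<lambda>k. integral {0..2 * pi} (f k)) \<longlonglongrightarrow> integral {0..2 * pi} g"
    proof (rule monotone_convergence_decreasing)
      show "f k integrable_on {0..2 * pi}" for k using f_int by blast
      show "f (Suc k) \<theta> \<le> f k \<theta>" for k \<theta>
        using s_dec[of k] R pos[of \<theta> k] pos[of \<theta> "Suc k"] by (auto simp: f_def)
      show "(\<lambda>k. f k \<theta>) \<longlonglongrightarrow> g \<theta>" for \<theta>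
      proof (cases "Z \<theta> = a")
        case False
        have "2 * ln (cmod (Z \<theta> - a)) = ln ((cmod (Z \<theta> - of_real 1 * a))\<^sup>2)"
          using False by (simp add: ln_realpow)
        also have "\<dots> = ln (R\<^sup>2 * 2 - 2 * Re (Z \<theta> * cnj a))"
          unfolding sq by simp
        finally have g_eq: "g \<theta> = ln (R\<^sup>2 * 2 - 2 * Re (Z \<theta> * cnj a)) / 2" unfolding g_def by simp
        have "0 < (cmod (Z \<theta> - of_real 1 * a))\<^sup>2" using False by simp
        then have "R\<^sup>2 * 2 - 2 * Re (Z \<theta> * cnj a) \<noteq> 0" unfolding sq by simp
        then have "(\<lambda>k. ln (R\<^sup>2 * s k - 2 * Re (Z \<theta> * cnj a)) / 2) \<longlonglongrightarrow> g \<theta>"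
          unfolding g_eq by (intro tendsto_intros s_lim) auto
        then show ?thesis using False by (simp add: f_def)
      qed (simp add: f_def g_def)
      have "range (\<lambda>k. integral {0..2 * pi} (f k)) = range (\<lambda>k. 2 * pi * ln R - pi * ln (t k))"
        by (simp only: integral_unique[OF f_int])
      then show "bounded (range (\<lambda>k. integral {0..2 * pi} (f k)))"
        using convergent_imp_bounded[OF int_lim] by simp
    qed
    moreover have "(\<lambda>k. integral {0..2 * pi} (f k)) \<longlonglongrightarrow> 2 * pi * ln R"
      using int_lim by (simp add: integral_unique[OF f_int])
    ultimately have "g integrable_on {0..2 * pi}" "integral {0..2 * pi} g = 2 * pi * ln R"
      using LIMSEQ_unique by blast+
    then have "(g has_integral 2 * pi * ln R) {0..2 * pi}" by (simp add: has_integral_iff)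
    then show ?thesis using 3 by (simp add: g_def[abs_def] Z_def)
  qed
qed

text \<open>An integrable function with a constant upper bound is absolutely integrable. Gauge
  integrability alone would not survive the passage from \<open>ln\<close> to its positive part
  \<open>log_plus\<close>.\<close>

lemma absolutely_integrable_circle_ln_dist:
  assumes R: "R > 0"
  shows "(\<lambda>\<theta>. ln (cmod (complex_of_real R * cis \<theta> - a))) absolutely_integrable_on {0..2 * pi}"
proof (rule absolutely_integrable_absolutely_integrable_ubound)
  show "(\<lambda>\<theta>. ln (cmod (complex_of_real R * cis \<theta> - a))) integrable_on {0..2 * pi}"
    using has_integral_circle_ln_dist[OF R] by blast
  show "(\<lambda>_. R + cmod a) absolutely_integrable_on {0..2 * pi}" by simp
  fix \<theta>
  have "cmod (complex_of_real R * cis \<theta> - a) \<le> R + cmod a"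
    using norm_triangle_ineq4[of "complex_of_real R * cis \<theta>" a] R by (simp add: norm_mult)
  moreover have "ln x \<le> x" if "x \<ge> 0" for x :: real
    using that ln_le_minus_one[of x] by (cases "x = 0") auto
  ultimately show "ln (cmod (complex_of_real R * cis \<theta> - a)) \<le> R + cmod a"
    using norm_ge_zero order_trans by blast
qed

section \<open>Jensen's formula\<close>

text \<open>Being nonzero off a sparse set is insensitive to the arbitrary values at singularities.
  It makes \<open>zorder\<close> meaningful everywhere and multiplication by the inverse cancel off
  a sparse set.\<close>

definition nonnull_meromorphic :: "(complex \<Rightarrow> complex) \<Rightarrow> bool" where
  "nonnull_meromorphic f \<longleftrightarrow> f meromorphic_on UNIV \<and> eventually (\<lambda>z. f z \<noteq> 0) (cosparse UNIV)"

lemma nonnull_meromorphic_at: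
  assumes "nonnull_meromorphic f"
  shows "f meromorphic_on A" "eventually (\<lambda>w. f w \<noteq> 0) (at z)" "frequently (\<lambda>w. f w \<noteq> 0) (at z)"
proof -
  show "f meromorphic_on A"
    using assms meromorphic_on_subset unfolding nonnull_meromorphic_def by blast
  show "eventually (\<lambda>w. f w \<noteq> 0) (at z)"
    using assms unfolding nonnull_meromorphic_def by (auto simp: eventually_cosparse_open_eq)
  then show "frequently (\<lambda>w. f w \<noteq> 0) (at z)"
    by (simp add: eventually_frequently)
qed

lemma nonnull_meromorphic_mult:
  assumes "nonnull_meromorphic f" "nonnull_meromorphic h"
  shows "nonnull_meromorphic (\<lambda>z. f z * h z)"
  using assms unfolding nonnull_meromorphic_def
  by (auto intro!: meromorphic_intros elim: eventually_elim2)

lemma nonnull_meromorphic_inverse: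
  assumes "nonnull_meromorphic f"
  shows "nonnull_meromorphic (\<lambda>z. inverse (f z))"
  using assms unfolding nonnull_meromorphic_def
  by (auto intro!: meromorphic_intros)

lemma is_pole_iff_zorder_neg:
  assumes "nonnull_meromorphic f"
  shows "is_pole f z \<longleftrightarrow> zorder f z < 0"
  using nonnull_meromorphic_at[OF assms] zorder_neg_imp_is_pole isolated_pole_imp_neg_zorder
    meromorphic_on_isolated_singularity by blast

lemma cosparse_zorder_eq_0:
  assumes "nonnull_meromorphic f"
  shows "eventually (\<lambda>z. zorder f z = 0) (cosparse UNIV)"
proof -
  have "f meromorphic_on UNIV" using assms by (simp add: nonnull_meromorphic_def)
  then have "eventually (\<lambda>z. \<not> is_pole f z) (cosparse UNIV)"
    "eventually (\<lambda>z. \<not> isolated_zero f z) (cosparse UNIV)"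
    by (rule meromorphic_on_imp_not_pole_cosparse meromorphic_on_imp_not_zero_cosparse)+
  then show ?thesis
    by eventually_elim
       (intro not_pole_not_isolated_zero_imp_zorder_eq_0 nonnull_meromorphic_at[OF assms])
qed

lemma finite_zorder_nonzero:
  assumes "nonnull_meromorphic f"
  shows "finite {z\<in>cball 0 r. zorder f z \<noteq> 0}"
proof -
  have "{z. zorder f z \<noteq> 0} sparse_in cball 0 r"
    using cosparse_zorder_eq_0[OF assms] unfolding eventually_cosparse by (rule sparse_in_subset) auto
  then have "finite (cball 0 r \<inter> {z. zorder f z \<noteq> 0})"
    by (rule sparse_in_compact_finite) auto
  then show ?thesis by (simp add: Int_def)
qed

lemma zorder_inverse:
  assumes "nonnull_meromorphic f"
  shows "zorder (\<lambda>z. inverse (f z)) a = - zorder f a"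
  using zorder_power_int[OF nonnull_meromorphic_at(1,3)[OF assms], of "-1" a]
  by (simp add: power_int_minus)

lemma zorder_minus_powi: "zorder (\<lambda>w. (w - a) powi n) z = (if z = a then n else 0)"
proof (cases "z = a")
  case True
  have "zorder (\<lambda>w. (w - a) powi n) a = n"
    by (rule zorder_eqI[where S = UNIV and g = "\<lambda>_. 1"]) auto
  then show ?thesis using True by simp
next
  case False
  have "zorder (\<lambda>w. (w - a) powi n) z = 0"
    by (rule zorder_eq_0I) (use False in \<open>auto intro!: analytic_intros\<close>)
  then show ?thesis using False by simp
qed

lemma nonnull_meromorphic_prod_powi:
  assumes "finite A"
  shows "nonnull_meromorphic (\<lambda>w. \<Prod>a\<in>A. (w - a) powi n a)"
  unfolding nonnull_meromorphic_def
proof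
  show "(\<lambda>w. \<Prod>a\<in>A. (w - a) powi n a) meromorphic_on UNIV"
    by (intro meromorphic_intros)
  have "eventually (\<lambda>z. z \<notin> A) (cosparse UNIV)"
    by (intro eventually_not_in_cosparse finite_imp_sparse assms)
  then show "eventually (\<lambda>w. (\<Prod>a\<in>A. (w - a) powi n a) \<noteq> 0) (cosparse UNIV)"
    by eventually_elim (auto simp: assms)
qed

lemma zorder_prod_powi:
  assumes "finite A"
  shows "zorder (\<lambda>w. \<Prod>a\<in>A. (w - a) powi n a) z = (if z \<in> A then n z else 0)"
proof -
  have "zorder (\<lambda>w. \<Prod>a\<in>A. (w - a) powi n a) z = (\<Sum>a\<in>A. zorder (\<lambda>w. (w - a) powi n a) z)"
    by (rule zorder_prod)
       (use nonnull_meromorphic_at(2)[OF nonnull_meromorphic_prod_powi[OF assms]] in \<open>auto intro!: meromorphic_intros\<close>)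
  also have "\<dots> = (\<Sum>a\<in>A. if z = a then n z else 0)"
    by (intro sum.cong refl) (simp add: zorder_minus_powi)
  finally show ?thesis using assms by simp
qed

text \<open>Cancelling the orders at the points of \<open>A\<close> leaves order 0 throughout the
  ball, so removing the singularities gives a zero-free holomorphic function. Points of order 0
  contribute the factor 1, hence \<open>A\<close> may be enlarged at will.\<close>

lemma meromorphic_factorization:
  assumes f: "nonnull_meromorphic f" and A: "finite A" "{z\<in>ball 0 S. zorder f z \<noteq> 0} \<subseteq> A"
  obtains h where "h holomorphic_on ball 0 S" "\<And>z. z \<in> ball 0 S \<Longrightarrow> h z \<noteq> 0"
    and "eventually (\<lambda>w. f w = h w * (\<Prod>a\<in>A. (w - a) powi zorder f a)) (cosparse UNIV)"
proof
  define F where "F w = f w * (\<Prod>a\<in>A. (w - a) powi (- zorder f a))" for w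
  have F: "nonnull_meromorphic F"
    unfolding F_def by (intro nonnull_meromorphic_mult f nonnull_meromorphic_prod_powi A)
  have zorder_F: "zorder F z = 0" if "z \<in> ball 0 S" for z
  proof -
    have "zorder F z = zorder f z + zorder (\<lambda>w. \<Prod>a\<in>A. (w - a) powi (- zorder f a)) z"
      unfolding F_def
      by (intro zorder_mult nonnull_meromorphic_at f nonnull_meromorphic_prod_powi A)
    then show ?thesis using A that by (auto simp: zorder_prod_powi)
  qed
  have h: "remove_sings F analytic_on {z} \<and> remove_sings F z \<noteq> 0" if "z \<in> ball 0 S" for z
  proof -
    have iso: "isolated_singularity_at F z" "not_essential F z"
      using nonnull_meromorphic_at(1)[OF F, of "{z}"] by (simp_all add: meromorphic_at_iff)
    have "\<not> is_pole F z" using is_pole_iff_zorder_neg[OF F] zorder_F[OF that] by simp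
    then obtain c where "F \<midarrow>z\<rightarrow> c" using iso(2) by (auto simp: not_essential_def)
    then have ana: "remove_sings F analytic_on {z}" using iso(1) by (rule remove_sings_analytic_at[rotated])
    have "frequently (\<lambda>w. remove_sings F w \<noteq> 0) (at z)"
      using eventually_remove_sings_eq_at[OF iso(1)] nonnull_meromorphic_at(2)[OF F, of z]
      by (intro eventually_frequently) (auto elim: eventually_elim2)
    moreover have "zorder (remove_sings F) z = 0"
      using zorder_F[OF that] iso by simp
    ultimately show ?thesis using ana zorder_eq_0_iff by blast
  qed
  show "remove_sings F holomorphic_on ball 0 S"
    using h analytic_on_analytic_at analytic_imp_holomorphic by blast
  show "remove_sings F z \<noteq> 0" if "z \<in> ball 0 S" for z using h[OF that] ..
  have "eventually (\<lambda>w. remove_sings F w = F w) (cosparse UNIV)"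
    by (intro eventually_remove_sings_eq nonnull_meromorphic_at F)
  moreover have "eventually (\<lambda>w. w \<notin> A) (cosparse UNIV)"
    by (intro eventually_not_in_cosparse finite_imp_sparse A)
  ultimately show "eventually (\<lambda>w. f w = remove_sings F w * (\<Prod>a\<in>A. (w - a) powi zorder f a)) (cosparse UNIV)"
  proof eventually_elim
    case (elim w)
    have "(\<Prod>a\<in>A. (w - a) powi (- zorder f a)) * (\<Prod>a\<in>A. (w - a) powi zorder f a)
        = (\<Prod>a\<in>A. 1)"
      unfolding prod.distrib[symmetric]
    proof (intro prod.cong refl)
      fix a assume "a \<in> A"
      then have "w - a \<noteq> 0" using elim by auto
      then show "(w - a) powi (- zorder f a) * (w - a) powi zorder f a = 1"
        by (simp add: power_int_minus)
    qed
    then show ?case using elim by (simp add: F_def mult.assoc)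
  qed
qed

text \<open>The contribution of a single zero at \<open>a\<close> to Jensen's formula, and of a single pole to \<^const>\<open>nevanlinna_N\<close>:
  it vanishes for \<open>\<bar>a\<bar> \<ge> r\<close>, \<open>a \<noteq> 0\<close>, so sums may run over any finite superset of the zeros and poles.\<close>

definition circle_weight :: "real \<Rightarrow> complex \<Rightarrow> real" where
  "circle_weight r a = (if a = 0 then ln r else ln (max r (cmod a)) - ln (cmod a))"

lemma circle_weight_nonneg: "r \<ge> 1 \<Longrightarrow> circle_weight r a \<ge> 0"
  by (auto simp: circle_weight_def)

lemma outside_weight_0:
  assumes "r > 0" "{z\<in>cball 0 r. zorder f z \<noteq> 0} \<subseteq> A" "a \<notin> A"
  shows "zorder f a = 0 \<or> circle_weight r a = 0"
proof (rule disjCI)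
  assume "circle_weight r a \<noteq> 0"
  then have "cmod a \<le> r" using assms(1) by (auto simp: circle_weight_def max_def split: if_splits)
  then show "zorder f a = 0" using assms(2,3) by auto
qed

lemma ln_cmod_prod_powi:
  assumes "finite A" "w \<notin> A"
  shows "ln (cmod (\<Prod>a\<in>A. (w - a) powi n a)) = (\<Sum>a\<in>A. of_int (n a) * ln (cmod (w - a)))"
proof -
  have pos: "cmod (w - a) > 0" if "a \<in> A" for a using assms that by auto
  have "ln (cmod (\<Prod>a\<in>A. (w - a) powi n a)) = ln (\<Prod>a\<in>A. cmod (w - a) powi n a)"
    by (simp add: prod_norm[symmetric] norm_power_int)
  also have "\<dots> = (\<Sum>a\<in>A. ln (cmod (w - a) powi n a))"
    by (rule ln_prod) (use assms pos in auto)
  also have "\<dots> = (\<Sum>a\<in>A. of_int (n a) * ln (cmod (w - a)))"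
    by (intro sum.cong refl) (use pos in \<open>simp add: powr_real_of_int'[symmetric] ln_powr less_imp_le\<close>)
  finally show ?thesis .
qed

lemma circle_ln_factorization:
  assumes f: "nonnull_meromorphic f" and A: "finite A" "{z\<in>ball 0 S. zorder f z \<noteq> 0} \<subseteq> A"
    and h: "h holomorphic_on ball 0 S" "\<And>z. z \<in> ball 0 S \<Longrightarrow> h z \<noteq> 0"
    "eventually (\<lambda>w. f w = h w * (\<Prod>a\<in>A. (w - a) powi zorder f a)) (cosparse UNIV)"
  and r: "0 < r" "r < S"
  shows "((\<lambda>\<theta>. ln (cmod (f (complex_of_real r * cis \<theta>)))) has_integral
            2 * pi * (ln (cmod (h 0)) + (\<Sum>a\<in>A. of_int (zorder f a) * ln (max r (cmod a))))) {0..2 * pi}"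
    and "(\<lambda>\<theta>. ln (cmod (f (complex_of_real r * cis \<theta>)))) absolutely_integrable_on {0..2 * pi}"
proof -
  let ?S = "\<lambda>w. \<Sum>a\<in>A. of_int (zorder f a) * ln (cmod (w - a))"
  \<comment> \<open>The factor \<open>h\<close> is controlled only in the ball. The second branch
    makes the identity below trivial elsewhere, so that it holds off a sparse subset of the whole
    plane; the circle only meets the first branch.\<close>
  define h' where "h' = (\<lambda>w. if w \<in> ball 0 S then ln (cmod (h w)) else ln (cmod (f w)) - ?S w)"
  have ev: "eventually (\<lambda>w. ln (cmod (f w)) = h' w + ?S w) (cosparse UNIV)"
    using h(3) eventually_not_in_cosparse[OF finite_imp_sparse[OF A(1)], of UNIV]
  proof eventually_elim
    case (elim w)
    show ?case
    proof (cases "w \<in> ball 0 S")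
      case True
      have nz: "(\<Prod>a\<in>A. (w - a) powi zorder f a) \<noteq> 0"
        using elim A by auto
      have "ln (cmod (f w)) = ln (cmod (h w)) + ln (cmod (\<Prod>a\<in>A. (w - a) powi zorder f a))"
        unfolding elim(1) norm_mult using h(2)[OF True] nz by (subst ln_mult) auto
      then show ?thesis using True elim A by (simp add: h'_def ln_cmod_prod_powi)
    qed (simp add: h'_def)
  qed
  have h'_eq: "h' (complex_of_real r * cis \<theta>) = ln (cmod (h (complex_of_real r * cis \<theta>)))" for \<theta>
    using r by (simp add: h'_def norm_mult)
  have ih: "((\<lambda>\<theta>. h' (complex_of_real r * cis \<theta>)) has_integral 2 * pi * ln (cmod (h 0))) {0..2 * pi}"
    unfolding h'_eq by (rule has_integral_circle_ln_nonvanishing[OF h(1,2)]) (use r in auto)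
  have "((\<lambda>\<theta>. h' (complex_of_real r * cis \<theta>) + ?S (complex_of_real r * cis \<theta>)) has_integral
     2 * pi * ln (cmod (h 0)) + (\<Sum>a\<in>A. of_int (zorder f a) * (2 * pi * ln (max r (cmod a))))) {0..2 * pi}"
    by (intro has_integral_add[OF ih] has_integral_sum A has_integral_mult_right has_integral_circle_ln_dist r)
  also have "2 * pi * ln (cmod (h 0)) + (\<Sum>a\<in>A. of_int (zorder f a) * (2 * pi * ln (max r (cmod a))))
     = 2 * pi * (ln (cmod (h 0)) + (\<Sum>a\<in>A. of_int (zorder f a) * ln (max r (cmod a))))"
    by (simp add: distrib_left sum_distrib_left mult_ac)
  finally show *: "((\<lambda>\<theta>. ln (cmod (f (complex_of_real r * cis \<theta>)))) has_integral
            2 * pi * (ln (cmod (h 0)) + (\<Sum>a\<in>A. of_int (zorder f a) * ln (max r (cmod a))))) {0..2 * pi}"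
    by (subst has_integral_circle_cong[OF ev r(1)])
  have "continuous_on {0..2 * pi} (\<lambda>\<theta>. ln (cmod (h (complex_of_real r * cis \<theta>))))"
    by (intro continuous_intros continuous_on_compose2[OF holomorphic_on_imp_continuous_on[OF h(1)]])
       (use r h(2) in \<open>auto simp: norm_mult\<close>)
  then have "(\<lambda>\<theta>. h' (complex_of_real r * cis \<theta>)) absolutely_integrable_on {0..2 * pi}"
    unfolding h'_eq by (rule absolutely_integrable_continuous_real)
  then have ai: "(\<lambda>\<theta>. h' (complex_of_real r * cis \<theta>) + ?S (complex_of_real r * cis \<theta>)) absolutely_integrable_on {0..2 * pi}"
    by (intro set_integral_add absolutely_integrable_sum A set_integrable_mult_right absolutely_integrable_circle_ln_dist r)
  define B where "B = {\<theta>\<in>{0..2 * pi}. complex_of_real r * cis \<theta> \<in> cball 0 r \<inter> {w. ln (cmod (f w)) \<noteq> h' w + ?S w}}"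
  have "{w. ln (cmod (f w)) \<noteq> h' w + ?S w} sparse_in cball 0 r"
    using ev unfolding eventually_cosparse by (rule sparse_in_subset) auto
  then have "finite B" unfolding B_def
    by (intro finite_circle_preimage sparse_in_compact_finite r) auto
  then show "(\<lambda>\<theta>. ln (cmod (f (complex_of_real r * cis \<theta>)))) absolutely_integrable_on {0..2 * pi}"
    by (intro absolutely_integrable_spike[OF ai negligible_finite]) (use r in \<open>auto simp: B_def norm_mult\<close>)
qed

text \<open>The constant is ln |C| for the leading Laurent coefficient \<open>C\<close> at 0. The
  zero-free factor depends on the radius, but \<open>C\<close> does not, and uniqueness of limits at
  0 expresses one through the other.\<close>

lemma jensen_formula:
  assumes f: "nonnull_meromorphic f"
  obtains c where "\<And>r A. r > 0 \<Longrightarrow> finite A \<Longrightarrow> {z\<in>cball 0 r. zorder f z \<noteq> 0} \<subseteq> A \<Longrightarrow>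
     circle_mean (\<lambda>z. ln (cmod (f z))) r = c + (\<Sum>a\<in>A. of_int (zorder f a) * circle_weight r a)"
proof -
  obtain C where C: "C \<noteq> 0" "((\<lambda>w. f w * w powi (- zorder f 0)) \<longlongrightarrow> C) (at 0)"
  proof
    define n where "n = zorder f 0"
    define g where "g = zor_poly f 0"
    have "isolated_singularity_at f 0" "not_essential f 0"
      using nonnull_meromorphic_at(1)[OF f, of "{0}"] by (simp_all add: meromorphic_at_iff)
    from zorder_exist[OF this nonnull_meromorphic_at(3)[OF f]] obtain r where
      g: "g 0 \<noteq> 0" "r > 0" "g holomorphic_on cball 0 r" "\<forall>w\<in>cball 0 r - {0}. f w = g w * (w - 0) powi n"
      unfolding g_def n_def by blast
    show "g 0 \<noteq> 0" by fact
    have "isCont g 0"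
      using g by (intro holomorphic_on_imp_continuous_on[THEN continuous_on_interior]) auto
    then have "g \<midarrow>0\<rightarrow> g 0" by (rule isContD)
    moreover have "eventually (\<lambda>w. w \<in> ball 0 r - {0}) (at 0)"
      using g(2) by (intro eventually_at_in_open) auto
    then have "eventually (\<lambda>w. g w = f w * w powi (- n)) (at 0)"
      by eventually_elim (use g(4) in \<open>auto simp: power_int_minus\<close>)
    ultimately show "((\<lambda>w. f w * w powi (- zorder f 0)) \<longlongrightarrow> g 0) (at 0)"
      unfolding n_def by (rule Lim_transform_eventually)
  qed
  show ?thesis
  proof
    fix r :: real and A assume r: "r > 0" and A: "finite A" "{z\<in>cball 0 r. zorder f z \<noteq> 0} \<subseteq> A"
    \<comment> \<open>The radius \<open>r + 1\<close> puts the closed disc inside the open ball of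
      the factorization; the point 0 is added so that its factor can be split off whatever its
      order.\<close>
    define A' where "A' = insert 0 (A \<union> {z\<in>cball 0 (r + 1). zorder f z \<noteq> 0})"
    have A': "finite A'" "{z\<in>ball 0 (r + 1). zorder f z \<noteq> 0} \<subseteq> A'"
      using A finite_zorder_nonzero[OF f] by (auto simp: A'_def)
    obtain h where h: "h holomorphic_on ball 0 (r + 1)" "\<And>z. z \<in> ball 0 (r + 1) \<Longrightarrow> h z \<noteq> 0"
      "eventually (\<lambda>w. f w = h w * (\<Prod>a\<in>A'. (w - a) powi zorder f a)) (cosparse UNIV)"
      using meromorphic_factorization[OF f A'] by blast
    have mean: "circle_mean (\<lambda>z. ln (cmod (f z))) r = ln (cmod (h 0)) + (\<Sum>a\<in>A'. of_int (zorder f a) * ln (max r (cmod a)))"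
      using circle_ln_factorization(1)[OF f A' h, of r] r unfolding circle_mean_def
      by (simp add: integral_unique)
    let ?P = "\<lambda>w. \<Prod>a\<in>A' - {0}. (w - a) powi zorder f a"
    have "isCont h 0"
      using h(1) r by (intro holomorphic_on_imp_continuous_on[THEN continuous_on_interior]) auto
    then have "h \<midarrow>0\<rightarrow> h 0" by (rule isContD)
    then have "((\<lambda>w. h w * ?P w) \<longlongrightarrow> h 0 * ?P 0) (at 0)"
      by (intro tendsto_intros) auto
    moreover have "eventually (\<lambda>w. h w * ?P w = f w * w powi (- zorder f 0)) (at 0)"
      using eventually_cosparse_imp_eventually_at[OF h(3) UNIV_I, of 0 UNIV] eventually_neq_at_within[of 0 0 UNIV]
    proof eventually_elim
      case (elim w)
      have "(\<Prod>a\<in>A'. (w - a) powi zorder f a) = w powi zorder f 0 * ?P w"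
        using A'(1) by (subst prod.remove[of _ 0]) (auto simp: A'_def)
      then show ?case using elim by (simp add: power_int_minus field_simps)
    qed
    ultimately have "((\<lambda>w. f w * w powi (- zorder f 0)) \<longlongrightarrow> h 0 * ?P 0) (at 0)"
      by (rule Lim_transform_eventually)
    then have "C = h 0 * ?P 0" using C(2) LIM_unique by blast
    moreover have "h 0 \<noteq> 0" using h(2) r by auto
    moreover have "?P 0 \<noteq> 0" using A'(1) by auto
    ultimately have lnC: "ln (cmod C) = ln (cmod (h 0)) + (\<Sum>a\<in>A' - {0}. of_int (zorder f a) * ln (cmod a))"
      using ln_cmod_prod_powi[of "A' - {0}" 0 "zorder f"] A'(1) by (simp add: norm_mult ln_mult)
    \<comment> \<open>Replacing ln |h 0| by ln |C| subtracts ln |a| for every nonzero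
      \<open>a\<close>, which turns ln (max r |a|) into \<open>circle_weight\<close>; the origin
      keeps its ln r.\<close>
    have "(\<Sum>a\<in>A'. of_int (zorder f a) * ln (max r (cmod a)))
        = of_int (zorder f 0) * ln r + (\<Sum>a\<in>A' - {0}. of_int (zorder f a) * ln (max r (cmod a)))"
      using A'(1) r by (subst sum.remove[of _ 0]) (auto simp: A'_def)
    moreover have "(\<Sum>a\<in>A'. of_int (zorder f a) * circle_weight r a)
        = of_int (zorder f 0) * ln r + (\<Sum>a\<in>A' - {0}. of_int (zorder f a) * (ln (max r (cmod a)) - ln (cmod a)))"
      using A'(1) by (subst sum.remove[of _ 0]) (auto simp: A'_def circle_weight_def)
    ultimately have "circle_mean (\<lambda>z. ln (cmod (f z))) r
        = ln (cmod C) + (\<Sum>a\<in>A'. of_int (zorder f a) * circle_weight r a)"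
      unfolding mean lnC by (simp add: right_diff_distrib sum_subtractf)
    also have "(\<Sum>a\<in>A'. of_int (zorder f a) * circle_weight r a) = (\<Sum>a\<in>A. of_int (zorder f a) * circle_weight r a)"
      by (rule sum.mono_neutral_right) (use A'(1) outside_weight_0[OF r A(2)] in \<open>auto simp: A'_def\<close>)
    finally show "circle_mean (\<lambda>z. ln (cmod (f z))) r = ln (cmod C) + (\<Sum>a\<in>A. of_int (zorder f a) * circle_weight r a)" .
  qed
qed

lemma log_plus_integrable:
  assumes f: "nonnull_meromorphic f" and r: "r > 0"
  shows "(\<lambda>\<theta>. log_plus (cmod (f (complex_of_real r * cis \<theta>)))) integrable_on {0..2 * pi}"
proof -
  have A: "finite {z\<in>cball 0 (r + 1). zorder f z \<noteq> 0}"
     "{z\<in>ball 0 (r + 1). zorder f z \<noteq> 0} \<subseteq> {z\<in>cball 0 (r + 1). zorder f z \<noteq> 0}"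
    using finite_zorder_nonzero[OF f] by auto
  obtain h where h: "h holomorphic_on ball 0 (r + 1)" "\<And>z. z \<in> ball 0 (r + 1) \<Longrightarrow> h z \<noteq> 0"
    "eventually (\<lambda>w. f w = h w * (\<Prod>a\<in>{z\<in>cball 0 (r + 1). zorder f z \<noteq> 0}. (w - a) powi zorder f a)) (cosparse UNIV)"
    using meromorphic_factorization[OF f A] by blast
  have "(\<lambda>\<theta>. ln (cmod (f (complex_of_real r * cis \<theta>)))) absolutely_integrable_on {0..2 * pi}"
    using circle_ln_factorization(2)[OF f A h, of r] r by simp
  then have "(\<lambda>\<theta>. max 0 (ln (cmod (f (complex_of_real r * cis \<theta>))))) absolutely_integrable_on {0..2 * pi}"
    by (intro absolutely_integrable_max_1) auto
  then show ?thesis unfolding log_plus_def by (rule set_lebesgue_integral_eq_integral(1))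
qed

section \<open>The characteristic of meromorphic functions\<close>

text \<open>Interchange of sum and integral: a pole of order k at a nonzero \<open>a\<close> in the
  disc contributes the integral of k / t from |a| to r. Poles at the origin are subtracted from the
  integrand and return as the separate term with ln r.\<close>

lemma nevanlinna_N_eq:
  assumes f: "nonnull_meromorphic f" and r: "r > 0"
    and A: "finite A" "{z\<in>cball 0 r. zorder f z \<noteq> 0} \<subseteq> A"
  shows "nevanlinna_N f r = (\<Sum>a\<in>A. real (nat (- zorder f a)) * circle_weight r a)"
proof -
  define k where "k a = real (nat (- zorder f a))" for a
  have count: "real (pole_count f t) = (\<Sum>a\<in>A. if cmod a \<le> t then k a else 0)" if "t \<le> r" for t
  proof -
    have "pole_count f t = (\<Sum>a\<in>{a\<in>A. cmod a \<le> t}. nat (- zorder f a))"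
      unfolding pole_count_def
      by (rule sum.mono_neutral_left) (use A that in \<open>auto simp: is_pole_iff_zorder_neg[OF f]\<close>)
    also have "\<dots> = (\<Sum>a\<in>A. if cmod a \<le> t then nat (- zorder f a) else 0)"
      using A(1) by (simp add: sum.inter_filter)
    finally show ?thesis by (simp add: k_def if_distrib cong: if_cong)
  qed
  have single: "((\<lambda>t. if a \<noteq> 0 \<and> cmod a \<le> t then k a / t else 0) has_integral
      (if a = 0 then 0 else k a * circle_weight r a)) {0..r}" for a
  proof (cases "a = 0 \<or> cmod a > r")
    case True
    then have "(if a = 0 then 0 else k a * circle_weight r a) = 0"
      using r by (auto simp: circle_weight_def)
    moreover have "((\<lambda>t. if a \<noteq> 0 \<and> cmod a \<le> t then k a / t else 0) has_integral 0) {0..r}"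
      by (rule has_integral_is_0) (use True in auto)
    ultimately show ?thesis by simp
  next
    case False
    have "((\<lambda>t. k a / t) has_integral (k a * ln r - k a * ln (cmod a))) {cmod a..r}"
    proof (rule fundamental_theorem_of_calculus)
      fix t assume "t \<in> {cmod a..r}"
      then have "t > 0" using False by (auto intro: less_le_trans[of 0 "cmod a"])
      then show "((\<lambda>t. k a * ln t) has_vector_derivative k a / t) (at t within {cmod a..r})"
        by (auto intro!: derivative_eq_intros simp: has_real_derivative_iff_has_vector_derivative[symmetric])
    qed (use False in auto)
    then have "((\<lambda>t. if t \<in> {cmod a..r} then k a / t else 0) has_integral (k a * ln r - k a * ln (cmod a))) {0..r}"
      by (subst has_integral_restrict) auto
    then have "((\<lambda>t. if a \<noteq> 0 \<and> cmod a \<le> t then k a / t else 0) has_integral (k a * ln r - k a * ln (cmod a))) {0..r}"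
      by (rule has_integral_eq[rotated]) (use False in auto)
    then show ?thesis using False by (simp add: circle_weight_def right_diff_distrib)
  qed
  have "((\<lambda>t. (real (pole_count f t) - real (pole_count f 0)) / t) has_integral
      (\<Sum>a\<in>A. if a = 0 then 0 else k a * circle_weight r a)) {0..r}"
  proof (rule has_integral_eq[OF _ has_integral_sum[OF A(1) single]])
    fix t assume t: "t \<in> {0..r}"
    show "(\<Sum>a\<in>A. if a \<noteq> 0 \<and> cmod a \<le> t then k a / t else 0) = (real (pole_count f t) - real (pole_count f 0)) / t"
      using t r by (simp add: count sum_subtractf[symmetric] sum_divide_distrib) 
         (intro sum.cong refl, auto)
  qed
  moreover have "real (pole_count f 0) * ln r = (\<Sum>a\<in>A. if a = 0 then k a * ln r else 0)"
    using r by (simp add: count sum_distrib_right if_distrib[of "\<lambda>x. x * _"] cong: if_cong)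
  ultimately have "nevanlinna_N f r = (\<Sum>a\<in>A. (if a = 0 then 0 else k a * circle_weight r a) + (if a = 0 then k a * ln r else 0))"
    unfolding nevanlinna_N_def sum.distrib by (simp add: integral_unique)
  also have "\<dots> = (\<Sum>a\<in>A. k a * circle_weight r a)"
    by (intro sum.cong) (auto simp: circle_weight_def)
  finally show ?thesis by (simp add: k_def)
qed

lemma nevanlinna_T_cong:
  assumes "eventually (\<lambda>z. f z = h z) (cosparse UNIV)" "r > 0"
  shows "nevanlinna_T f r = nevanlinna_T h r"
proof -
  have at: "eventually (\<lambda>w. f w = h w) (at z)" for z
    using assms(1) by (auto simp: eventually_cosparse_open_eq)
  have "pole_count f = pole_count h"
    unfolding pole_count_def[abs_def] is_pole_cong[OF at refl] zorder_cong[OF at refl] ..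
  moreover have "nevanlinna_m f r = nevanlinna_m h r"
    unfolding nevanlinna_m_eq using assms(1)
    by (intro circle_mean_cong[OF _ assms(2)]) (auto elim: eventually_mono)
  ultimately show ?thesis by (simp add: nevanlinna_T_def nevanlinna_N_def)
qed

text \<open>Jensen's formula split by sign: ln x = log+ x - log+ (1/x) splits the mean, and the
  positive and negative parts of \<open>zorder\<close> count the poles of the inverse and of
  \<open>f\<close>.\<close>

lemma nevanlinna_T_inverse:
  assumes f: "nonnull_meromorphic f"
  obtains c where "\<And>r. r > 0 \<Longrightarrow> nevanlinna_T (\<lambda>z. inverse (f z)) r = nevanlinna_T f r + c"
proof -
  obtain c where c: "\<And>r A. r > 0 \<Longrightarrow> finite A \<Longrightarrow> {z\<in>cball 0 r. zorder f z \<noteq> 0} \<subseteq> A \<Longrightarrow>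
     circle_mean (\<lambda>z. ln (cmod (f z))) r = c + (\<Sum>a\<in>A. of_int (zorder f a) * circle_weight r a)"
    using jensen_formula[OF f] by blast
  show ?thesis
  proof
    fix r :: real assume r: "r > 0"
    define A where "A = {z\<in>cball 0 r. zorder f z \<noteq> 0}"
    have A: "finite A" unfolding A_def by (rule finite_zorder_nonzero[OF f])
    have inv: "nonnull_meromorphic (\<lambda>z. inverse (f z))" by (rule nonnull_meromorphic_inverse[OF f])
    \<comment> \<open>At 0 both sides vanish, because \<open>inverse 0 = 0\<close> and
      \<open>ln 0 = 0\<close>.\<close>
    have "log_plus (cmod z) - log_plus (cmod (inverse z)) = ln (cmod z)" for z
      by (cases "z = 0") (auto simp: log_plus_def norm_inverse ln_inverse max_def)
    then have ln_eq: "ln (cmod (f z)) = log_plus (cmod (f z)) - log_plus (cmod (inverse (f z)))" for z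
      by simp
    have "circle_mean (\<lambda>z. ln (cmod (f z))) r = nevanlinna_m f r - nevanlinna_m (\<lambda>z. inverse (f z)) r"
      unfolding nevanlinna_m_eq ln_eq circle_mean_def
      using log_plus_integrable[OF f r] log_plus_integrable[OF inv r]
      by (simp add: integral_diff right_diff_distrib)
    moreover have "circle_mean (\<lambda>z. ln (cmod (f z))) r = c + (\<Sum>a\<in>A. of_int (zorder f a) * circle_weight r a)"
      by (rule c[OF r A]) (simp add: A_def)
    moreover have "nevanlinna_N f r = (\<Sum>a\<in>A. real (nat (- zorder f a)) * circle_weight r a)"
      by (rule nevanlinna_N_eq[OF f r A]) (simp add: A_def)
    moreover have "nevanlinna_N (\<lambda>z. inverse (f z)) r = (\<Sum>a\<in>A. real (nat (zorder f a)) * circle_weight r a)"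
      using nevanlinna_N_eq[OF inv r A] by (simp add: zorder_inverse[OF f] A_def)
    moreover have "(\<Sum>a\<in>A. of_int (zorder f a) * circle_weight r a) =
       (\<Sum>a\<in>A. real (nat (zorder f a)) * circle_weight r a) - (\<Sum>a\<in>A. real (nat (- zorder f a)) * circle_weight r a)"
      unfolding sum_subtractf[symmetric] left_diff_distrib[symmetric]
      by (intro sum.cong arg_cong2[of _ _ _ _ "(*)"]) auto
    ultimately show "nevanlinna_T (\<lambda>z. inverse (f z)) r = nevanlinna_T f r + - c"
      unfolding nevanlinna_T_def by simp
  qed
qed

lemma log_plus_mult: "x \<ge> 0 \<Longrightarrow> y \<ge> 0 \<Longrightarrow> log_plus (x * y) \<le> log_plus x + log_plus y"
  by (cases "x = 0 \<or> y = 0") (auto simp: log_plus_def ln_mult)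

text \<open>Cancellation of poles against zeros lowers the pole orders. For \<open>r \<ge> 1\<close>
  all weights are nonnegative, including ln r at the origin, so it lowers the sum as well.\<close>

lemma nevanlinna_T_mult_le:
  assumes f: "nonnull_meromorphic f" and h: "nonnull_meromorphic h" and r: "r \<ge> 1"
  shows "nevanlinna_T (\<lambda>z. f z * h z) r \<le> nevanlinna_T f r + nevanlinna_T h r"
proof -
  have fh: "nonnull_meromorphic (\<lambda>z. f z * h z)" by (rule nonnull_meromorphic_mult[OF f h])
  have r0: "r > 0" using r by simp
  have "nevanlinna_m (\<lambda>z. f z * h z) r \<le> circle_mean (\<lambda>z. log_plus (cmod (f z)) + log_plus (cmod (h z))) r"
    unfolding nevanlinna_m_eq
    by (rule circle_mean_mono)
       (use r0 in \<open>auto simp: norm_mult log_plus_mult intro!: integrable_add log_plus_integrable[OF f] log_plus_integrable[OF h] log_plus_integrable[OF fh, simplified norm_mult]\<close>)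
  also have "\<dots> = nevanlinna_m f r + nevanlinna_m h r"
    unfolding nevanlinna_m_eq circle_mean_def
    using log_plus_integrable[OF f r0] log_plus_integrable[OF h r0]
    by (simp add: integral_add distrib_left)
  finally have m: "nevanlinna_m (\<lambda>z. f z * h z) r \<le> nevanlinna_m f r + nevanlinna_m h r" .
  define A where "A = {z\<in>cball 0 r. zorder f z \<noteq> 0} \<union> {z\<in>cball 0 r. zorder h z \<noteq> 0}"
  have A: "finite A" unfolding A_def using finite_zorder_nonzero[OF f] finite_zorder_nonzero[OF h] by simp
  have zo: "zorder (\<lambda>z. f z * h z) a = zorder f a + zorder h a" for a
    by (intro zorder_mult nonnull_meromorphic_at f h)
  have "nevanlinna_N (\<lambda>z. f z * h z) r = (\<Sum>a\<in>A. real (nat (- zorder (\<lambda>z. f z * h z) a)) * circle_weight r a)"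
    by (rule nevanlinna_N_eq[OF fh r0 A]) (auto simp: A_def zo)
  also have "\<dots> \<le> (\<Sum>a\<in>A. (real (nat (- zorder f a)) + real (nat (- zorder h a))) * circle_weight r a)"
    by (intro sum_mono mult_right_mono circle_weight_nonneg r) (auto simp: zo)
  also have "\<dots> = nevanlinna_N f r + nevanlinna_N h r"
  proof -
    have "nevanlinna_N f r = (\<Sum>a\<in>A. real (nat (- zorder f a)) * circle_weight r a)"
      by (rule nevanlinna_N_eq[OF f r0 A]) (auto simp: A_def)
    moreover have "nevanlinna_N h r = (\<Sum>a\<in>A. real (nat (- zorder h a)) * circle_weight r a)"
      by (rule nevanlinna_N_eq[OF h r0 A]) (auto simp: A_def)
    ultimately show ?thesis by (simp add: distrib_right sum.distrib)
  qed
  finally show ?thesis using m by (simp add: nevanlinna_T_def)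
qed

lemma nevanlinna_T_const:
  assumes "eventually (\<lambda>z. f z = c) (cosparse UNIV)" "r > 0"
  shows "nevanlinna_T f r = log_plus (cmod c)"
proof -
  have "nevanlinna_T f r = nevanlinna_T (\<lambda>_. c) r"
    by (rule nevanlinna_T_cong[OF assms])
  also have "\<dots> = log_plus (cmod c)"
    by (simp add: nevanlinna_T_entire nevanlinna_m_def)
  finally show ?thesis .
qed

lemma nevanlinna_m_nonneg: "nevanlinna_m f r \<ge> 0"
proof (cases "(\<lambda>\<theta>. log_plus (cmod (f (complex_of_real r * cis \<theta>)))) integrable_on {0..2 * pi}")
  case True
  then show ?thesis unfolding nevanlinna_m_def
    by (intro mult_nonneg_nonneg integral_nonneg) (auto simp: log_plus_nonneg)
qed (simp add: nevanlinna_m_def not_integrable_integral)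

text \<open>A single pole \<open>b\<close> already forces growth like ln r through
  \<open>nevanlinna_N\<close>. Without poles, \<open>f\<close> agrees off a sparse set with a
  nonconstant entire function.\<close>

lemma nevanlinna_T_at_top:
  assumes f: "f meromorphic_on UNIV" and nc: "\<And>c. \<not> eventually (\<lambda>z. f z = c) (cosparse UNIV)"
  shows "filterlim (nevanlinna_T f) at_top at_top" and "nonnull_meromorphic f"
proof -
  show nn: "nonnull_meromorphic f"
    unfolding nonnull_meromorphic_def
    using meromorphic_imp_constant_or_avoid[OF f, of 0] f nc by auto
  show "filterlim (nevanlinna_T f) at_top at_top"
  proof (cases "\<exists>b. is_pole f b")
    case True
    then obtain b where b: "is_pole f b" by blast
    have k: "nat (- zorder f b) \<ge> 1" using b is_pole_iff_zorder_neg[OF nn] by auto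
    have "filterlim (\<lambda>r. if b = 0 then ln r else ln r - ln (cmod b)) at_top at_top"
      by (cases "b = 0") (simp_all, real_asymp+)
    moreover have "eventually (\<lambda>r. (if b = 0 then ln r else ln r - ln (cmod b)) \<le> nevanlinna_T f r) at_top"
      using eventually_ge_at_top[of "max 1 (cmod b)"]
    proof eventually_elim
      case (elim r)
      then have r: "r \<ge> 1" "r > 0" "cmod b \<le> r" by auto
      define A where "A = {z\<in>cball 0 r. zorder f z \<noteq> 0}"
      have A: "finite A" unfolding A_def by (rule finite_zorder_nonzero[OF nn])
      have bA: "b \<in> A" using k r by (auto simp: A_def)
      have "(if b = 0 then ln r else ln r - ln (cmod b)) = 1 * circle_weight r b"
        using r by (auto simp: circle_weight_def)
      also have "\<dots> \<le> real (nat (- zorder f b)) * circle_weight r b"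
        by (intro mult_right_mono circle_weight_nonneg r) (use k in linarith)
      also have "\<dots> \<le> (\<Sum>a\<in>A. real (nat (- zorder f a)) * circle_weight r a)"
        by (rule member_le_sum[OF bA]) (use A r circle_weight_nonneg in auto)
      also have "\<dots> = nevanlinna_N f r"
        using nevanlinna_N_eq[OF nn r(2) A] by (simp add: A_def)
      also have "\<dots> \<le> nevanlinna_T f r"
        using nevanlinna_m_nonneg[of f r] by (simp add: nevanlinna_T_def)
      finally show ?case .
    qed
    ultimately show ?thesis using filterlim_at_top_mono by blast
  next
    case False
    define g where "g = remove_sings f"
    have eq: "eventually (\<lambda>z. f z = g z) (cosparse UNIV)"
      using eventually_remove_sings_eq[OF f] unfolding g_def by (auto elim: eventually_mono)
    have at: "eventually (\<lambda>w. f w = g w) (at z)" for z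
      using eq by (auto simp: eventually_cosparse_open_eq)
    have "g analytic_on UNIV"
      unfolding g_def
      by (rule nicely_meromorphic_without_singularities[OF remove_sings_nicely_meromorphic[OF f]])
         (use False is_pole_cong[OF at refl] in \<open>auto simp: g_def\<close>)
    then have g: "g holomorphic_on UNIV" by (rule analytic_imp_holomorphic)
    have "\<not> g constant_on UNIV"
    proof
      assume "g constant_on UNIV"
      then obtain c where "\<And>z. g z = c" by (auto simp: constant_on_def)
      then show False using eq nc by simp
    qed
    from nevanlinna_m_at_top[OF g this] show ?thesis
    proof (rule filterlim_at_top_mono)
      show "eventually (\<lambda>r. nevanlinna_m g r \<le> nevanlinna_T f r) at_top"
        using eventually_gt_at_top[of 0]
        by eventually_elim (simp add: nevanlinna_T_cong[OF eq] nevanlinna_T_entire[OF g])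
    qed
  qed
qed

section \<open>Entire functions with Property (A)\<close>

context
  fixes g :: "complex \<Rightarrow> complex"
  assumes g: "g holomorphic_on UNIV" and nc: "\<not> g constant_on UNIV"
begin

lemma nevanlinna_T_mono: "0 < r \<Longrightarrow> r \<le> R \<Longrightarrow> nevanlinna_T g r \<le> nevanlinna_T g R"
  using nevanlinna_m_mono[OF g] by (simp add: nevanlinna_T_entire[OF g])

lemma nevanlinna_T_entire_at_top: "filterlim (nevanlinna_T g) at_top at_top"
  using nevanlinna_m_at_top[OF g nc] nevanlinna_T_entire[OF g] by presburger

lemma cmod_le_max_modulus: "cmod z = r \<Longrightarrow> cmod (g z) \<le> max_modulus g r"
  unfolding max_modulus_def
  by (intro cSUP_upper bounded_imp_bdd_above compact_imp_bounded compact_continuous_image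
        continuous_intros entire_continuous[OF g]) auto

lemma ln_max_modulus_le:
  assumes "r > 0"
  shows "ln (max_modulus g r) \<le> 3 * nevanlinna_T g (2 * r)"
proof -
  have "\<exists>z\<in>sphere 0 r. \<forall>w\<in>sphere 0 r. cmod (g w) \<le> cmod (g z)"
    using assms
    by (intro continuous_attains_sup continuous_intros entire_continuous[OF g])
       (auto simp: sphere_eq_empty)
  then obtain z where z: "z \<in> sphere 0 r" "\<And>w. w \<in> sphere 0 r \<Longrightarrow> cmod (g w) \<le> cmod (g z)"
    by blast
  have "max_modulus g r = cmod (g z)"
    unfolding max_modulus_def by (rule cSup_eq_maximum) (use z in auto)
  then have "ln (max_modulus g r) \<le> log_plus (cmod (g z))" using ln_le_log_plus by simp
  also have "\<dots> \<le> 3 * nevanlinna_T g (2 * r)"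
    using log_plus_le_nevanlinna_m[OF g assms, of z] z(1) by (simp add: nevanlinna_T_entire[OF g])
  finally show ?thesis .
qed

lemma nevanlinna_T_le_log_plus_max_modulus:
  assumes "r > 0"
  shows "nevanlinna_T g r \<le> log_plus (max_modulus g r)"
proof -
  have "nevanlinna_m g r \<le> circle_mean (\<lambda>_. log_plus (max_modulus g r)) r"
    unfolding nevanlinna_m_eq
    by (rule circle_mean_mono)
       (use assms in \<open>auto intro!: log_plus_mono cmod_le_max_modulus entire_log_plus_integrable[OF g]\<close>)
  then show ?thesis by (simp add: nevanlinna_T_entire[OF g] circle_mean_def)
qed

text \<open>Once T_g is positive, \<open>log_plus\<close> of the maximum modulus is positive too and
  hence equals \<open>ln\<close>.\<close>

lemma eventually_ln_max_modulus_ge: "eventually (\<lambda>r. nevanlinna_T g r \<le> ln (max_modulus g r) \<and> 0 < max_modulus g r) at_top"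
proof -
  have "eventually (\<lambda>r. nevanlinna_T g r > 0) at_top"
    using nevanlinna_T_entire_at_top by (simp add: filterlim_at_top_dense)
  then show ?thesis
    using eventually_gt_at_top[of 0]
  proof eventually_elim
    case (elim r)
    have "cmod (g (of_real r)) \<le> max_modulus g r" using elim by (intro cmod_le_max_modulus) simp
    then have "max_modulus g r \<ge> 0" using norm_ge_zero order_trans by blast
    then show ?case
      using nevanlinna_T_le_log_plus_max_modulus[of r] elim
      by (cases "max_modulus g r = 0") (auto simp: log_plus_def max_def split: if_splits)
  qed
qed

lemma property_A_ln:
  assumes A: "property_A g" and \<sigma>: "\<sigma> > 1"
  shows "eventually (\<lambda>r. 2 * ln (max_modulus g r) \<le> ln (max_modulus g (r powr \<sigma>))) at_top"
proof -
  have "eventually (\<lambda>r. (max_modulus g r)\<^sup>2 \<le> max_modulus g (r powr \<sigma>)) at_top"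
    using A \<sigma> by (simp add: property_A_def)
  then show ?thesis
    using eventually_ln_max_modulus_ge
  proof eventually_elim
    case (elim r)
    then have "ln ((max_modulus g r)\<^sup>2) \<le> ln (max_modulus g (r powr \<sigma>))"
      by (intro ln_mono) auto
    then show ?case using elim by (simp add: ln_realpow)
  qed
qed

text \<open>The exponent is split as \<open>\<tau> * \<tau> = \<sigma>\<close>, one factor for the
  induction hypothesis and one for a further doubling. The induction therefore has to range over all
  exponents.\<close>

lemma property_A_iterated:
  assumes A: "property_A g" and \<sigma>: "\<sigma> > 1"
  shows "eventually (\<lambda>r. 2 ^ Suc k * ln (max_modulus g r) \<le> ln (max_modulus g (r powr \<sigma>))) at_top"
  using \<sigma>
proof (induction k arbitrary: \<sigma>)
  case 0
  then show ?case using property_A_ln[OF A] by simp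
next
  case (Suc k)
  define \<tau> where "\<tau> = sqrt \<sigma>"
  have \<tau>: "\<tau> > 1" "\<tau> * \<tau> = \<sigma>" using Suc.prems by (simp_all add: \<tau>_def)
  have "filterlim (\<lambda>r::real. r powr \<tau>) at_top at_top" using \<tau> by real_asymp
  from eventually_compose_filterlim[OF property_A_ln[OF A \<tau>(1)] this]
  show ?case using Suc.IH[OF \<tau>(1)]
    by eventually_elim (simp add: powr_powr \<tau>(2))
qed

text \<open>T_g and ln M_g are comparable up to a factor 3 and a doubling of the radius. The factor
  goes into the choice of \<open>k\<close>, the doubling into the gap between \<open>\<tau>\<close>
  and \<open>\<sigma>\<close>.\<close>

lemma property_A_nevanlinna_T:
  assumes A: "property_A g" and \<sigma>: "\<sigma> > 1"
  shows "eventually (\<lambda>r. K * nevanlinna_T g r \<le> nevanlinna_T g (r powr \<sigma>)) at_top"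
proof -
  define \<tau> where "\<tau> = sqrt \<sigma>"
  have \<tau>: "\<tau> > 1" "\<tau> < \<sigma>" using \<sigma> real_less_lsqrt[of \<sigma> \<sigma>] by (simp_all add: \<tau>_def power2_eq_square)
  obtain k where k: "3 * K < 2 ^ k" using real_arch_pow[of 2 "3 * K"] by auto
  have "eventually (\<lambda>r::real. 2 * r powr \<tau> \<le> r powr \<sigma>) at_top" using \<tau> by real_asymp
  moreover have "eventually (\<lambda>r. nevanlinna_T g r > 0) at_top"
    using nevanlinna_T_entire_at_top by (simp add: filterlim_at_top_dense)
  ultimately show ?thesis
    using property_A_iterated[OF A \<tau>(1), of k] eventually_ln_max_modulus_ge eventually_gt_at_top[of 0]
  proof eventually_elim
    case (elim r)
    have "3 * K * nevanlinna_T g r \<le> 2 ^ Suc k * nevanlinna_T g r"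
      using k elim(2) by (intro mult_right_mono) (auto intro: order_trans[of _ "2 ^ k"])
    also have "\<dots> \<le> 2 ^ Suc k * ln (max_modulus g r)"
      using elim by (intro mult_left_mono) auto
    also have "\<dots> \<le> ln (max_modulus g (r powr \<tau>))" using elim by simp
    also have "\<dots> \<le> 3 * nevanlinna_T g (2 * r powr \<tau>)"
      using elim by (intro ln_max_modulus_le) auto
    also have "\<dots> \<le> 3 * nevanlinna_T g (r powr \<sigma>)"
      using elim by (intro mult_left_mono nevanlinna_T_mono) auto
    finally show ?case by simp
  qed
qed

text \<open>Surjectivity for large \<open>s\<close> comes from the intermediate value theorem. Which
  preimage is selected is immaterial, since later comparisons go through T_g.\<close>

lemma eventually_nevanlinna_T_inv:
  "eventually (\<lambda>s. nevanlinna_T_inv g s > 0 \<and> nevanlinna_T g (nevanlinna_T_inv g s) = s) at_top"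
  using eventually_ge_at_top[of "nevanlinna_T g 1"]
proof eventually_elim
  case (elim s)
  have "eventually (\<lambda>R. nevanlinna_T g R \<ge> s) at_top"
    using nevanlinna_T_entire_at_top by (simp add: filterlim_at_top)
  then obtain R where R: "R \<ge> 1" "nevanlinna_T g R \<ge> s"
    using eventually_ge_at_top[of 1] by (metis (mono_tags, lifting) eventually_happens' eventually_conj trivial_limit_at_top_linorder)
  have "continuous_on {1..R} (nevanlinna_T g)"
    using nevanlinna_m_continuous[OF g] continuous_on_subset[of "{0<..}" "nevanlinna_m g" "{1..R}"]
    by (simp add: nevanlinna_T_entire[OF g, abs_def] subset_eq)
  then obtain x where "1 \<le> x" "nevanlinna_T g x = s"
    using IVT'[of "nevanlinna_T g" 1 s R] elim R by auto
  then have "s \<in> nevanlinna_T g ` {0<..}" by force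
  then show ?case
    unfolding nevanlinna_T_inv_def using inv_into_into f_inv_into_f by (metis greaterThan_iff)
qed

lemma nevanlinna_T_inv_at_top: "filterlim (nevanlinna_T_inv g) at_top at_top"
  unfolding filterlim_at_top
proof
  fix B :: real
  show "eventually (\<lambda>s. B \<le> nevanlinna_T_inv g s) at_top"
    using eventually_nevanlinna_T_inv eventually_gt_at_top[of "nevanlinna_T g (max B 1)"]
  proof eventually_elim
    case (elim s)
    show ?case
    proof (rule ccontr)
      assume "\<not> B \<le> nevanlinna_T_inv g s"
      then have "nevanlinna_T g (nevanlinna_T_inv g s) \<le> nevanlinna_T g (max B 1)"
        using elim by (intro nevanlinna_T_mono) auto
      then show False using elim by simp
    qed
  qed
qed

end

section \<open>Growth quotients\<close>

lemma iter_log_Suc: "iter_log (Suc k) x = ln (iter_log k x)"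
  by (simp add: iter_log_def)

lemma iter_log_at_top: "filterlim (iter_log k) at_top at_top"
proof (induction k)
  case 0
  show ?case by (simp add: iter_log_def filterlim_ident id_def)
next
  case (Suc k)
  then show ?case
    unfolding iter_log_Suc[abs_def] by (rule filterlim_compose[OF ln_at_top])
qed

lemma eventually_iter_log_pos: "eventually (\<lambda>x. iter_log k x > 0) at_top"
  using iter_log_at_top by (simp add: filterlim_at_top_dense)

text \<open>With the quantifier inside, the larger argument may be any other function of r after
  composition with a limit.\<close>

lemma eventually_iter_log_mono: "eventually (\<lambda>x. \<forall>y\<ge>x. iter_log k x \<le> iter_log k y) at_top"
proof (induction k)
  case 0
  show ?case by (simp add: iter_log_def)
next
  case (Suc k)
  then show ?case using eventually_iter_log_pos[of k]
    by eventually_elim (auto simp: iter_log_Suc intro!: ln_mono)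
qed

text \<open>The first logarithm turns the exponent into a factor exactly. Each further one turns the
  factor into the summand \<open>ln \<sigma>\<close>, which is absorbed once the iterated logarithm
  exceeds \<open>ln \<sigma> / (\<sigma> - 1)\<close>.\<close>

lemma eventually_iter_log_powr:
  assumes "\<sigma> > 1" "k > 0"
  shows "eventually (\<lambda>x. iter_log k (x powr \<sigma>) \<le> \<sigma> * iter_log k x) at_top"
  using assms(2)
proof (induction k rule: nat_induct_non_zero)
  case 1
  show ?case using eventually_gt_at_top[of 0]
    by eventually_elim (simp add: iter_log_def ln_powr)
next
  case (Suc k)
  have lim: "filterlim (\<lambda>r::real. r powr \<sigma>) at_top at_top" using assms by real_asymp
  have "eventually (\<lambda>x. iter_log (Suc k) x \<ge> ln \<sigma> / (\<sigma> - 1)) at_top"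
    using iter_log_at_top[of "Suc k"] by (simp add: filterlim_at_top)
  then show ?case
    using Suc.IH eventually_iter_log_pos[of k] eventually_compose_filterlim[OF eventually_iter_log_pos[of k] lim]
  proof eventually_elim
    case (elim x)
    have "iter_log (Suc k) (x powr \<sigma>) \<le> ln (\<sigma> * iter_log k x)"
      unfolding iter_log_Suc by (rule ln_mono) (use elim in auto)
    also have "\<dots> = ln \<sigma> + iter_log (Suc k) x"
      unfolding iter_log_Suc using elim assms by (subst ln_mult) auto
    also have "ln \<sigma> \<le> (\<sigma> - 1) * iter_log (Suc k) x"
      using elim(1) assms by (simp add: field_simps)
    finally show ?case by (simp add: algebra_simps)
  qed
qed

text \<open>Choose c < d strictly between the two sides and take \<open>\<sigma> = d / c\<close>:
  then max(y, z) > c eventually, and z < c eventually, so y exceeds c. Nonnegativity of z makes c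
  positive and the quotient meaningful.\<close>

lemma Liminf_le_max_Limsup:
  fixes x y z :: "'a \<Rightarrow> real"
  assumes le: "\<And>\<sigma>. \<sigma> > 1 \<Longrightarrow> eventually (\<lambda>r. x r \<le> \<sigma> * max (y r) (z r)) F"
    and z: "eventually (\<lambda>r. z r \<ge> 0) F" and F: "F \<noteq> bot"
  shows "Liminf F (\<lambda>r. ereal (x r)) \<le> max (Liminf F (\<lambda>r. ereal (y r))) (Limsup F (\<lambda>r. ereal (z r)))"
proof (rule ccontr)
  let ?M = "max (Liminf F (\<lambda>r. ereal (y r))) (Limsup F (\<lambda>r. ereal (z r)))"
  assume "\<not> ?thesis"
  then have "?M < Liminf F (\<lambda>r. ereal (x r))" by (simp only: not_le)
  then obtain d where d: "?M < ereal d" "ereal d < Liminf F (\<lambda>r. ereal (x r))"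
    using ereal_dense2 by blast
  obtain c where c: "?M < ereal c" "c < d"
    using ereal_dense2[OF d(1)] by auto
  have "0 \<le> Limsup F (\<lambda>r. ereal (z r))"
    by (rule le_Limsup[OF F]) (use z in \<open>auto elim: eventually_mono\<close>)
  also have "\<dots> < ereal c" using c by simp
  finally have c0: "c > 0" by simp
  have "eventually (\<lambda>r. y r \<ge> c) F"
  proof -
    have dc: "d / c > 1" using c c0 by simp
    have "eventually (\<lambda>r. ereal (z r) < ereal c) F"
      by (rule Limsup_lessD) (use c in simp)
    then show ?thesis
      using le[OF dc] less_LiminfD[OF d(2)]
    proof eventually_elim
      case (elim r)
      then have "d < d / c * max (y r) (z r)" by simp
      then have "d * c < d * max (y r) (z r)" using c0 by (simp add: field_simps)
      then have "c < max (y r) (z r)" using c c0 by (simp add: mult_less_cancel_left_pos)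
      then show ?case using elim by simp
    qed
  qed
  then have "ereal c \<le> Liminf F (\<lambda>r. ereal (y r))"
    by (intro Liminf_bounded) (auto elim: eventually_mono)
  then show False using c(1) by (metis max_less_iff_conj not_le)
qed

section \<open>Relative growth with respect to a fixed entire function\<close>

context
  fixes p q :: nat and \<phi> :: "real \<Rightarrow> real" and g :: "complex \<Rightarrow> complex"
  assumes p: "p > 0" and \<phi>: "filterlim \<phi> at_top at_top"
    and g: "g holomorphic_on UNIV" and nc: "\<not> g constant_on UNIV"
begin

lemma iter_log_phi_at_top: "filterlim (\<lambda>r. iter_log q (\<phi> r)) at_top at_top"
  by (rule filterlim_compose[OF iter_log_at_top \<phi>])

lemma nevanlinna_T_inv_T_at_top:
  assumes "filterlim (nevanlinna_T f) at_top at_top"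
  shows "filterlim (\<lambda>r. nevanlinna_T_inv g (nevanlinna_T f r)) at_top at_top"
  by (rule filterlim_compose[OF nevanlinna_T_inv_at_top[OF g nc] assms])

lemma eventually_growth_quotient_nonneg:
  assumes "filterlim (nevanlinna_T f) at_top at_top"
  shows "eventually (\<lambda>r. growth_quotient p q \<phi> g f r \<ge> 0) at_top"
  using eventually_compose_filterlim[OF eventually_iter_log_pos[of p] nevanlinna_T_inv_T_at_top[OF assms]]
    eventually_compose_filterlim[OF eventually_iter_log_pos[of q] \<phi>]
  by eventually_elim (simp add: growth_quotient_def)

lemma growth_quotient_le_max:
  assumes A: "property_A g" and \<sigma>: "\<sigma> > 1"
    and f: "filterlim (nevanlinna_T f) at_top at_top"
    and a: "filterlim (nevanlinna_T a) at_top at_top"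
    and b: "filterlim (nevanlinna_T b) at_top at_top"
    and le: "eventually (\<lambda>r. nevanlinna_T f r \<le> nevanlinna_T a r + nevanlinna_T b r + C) at_top"
  shows "eventually (\<lambda>r. growth_quotient p q \<phi> g f r
           \<le> \<sigma> * max (growth_quotient p q \<phi> g a r) (growth_quotient p q \<phi> g b r)) at_top"
proof -
  define X where "X f r = nevanlinna_T_inv g (nevanlinna_T f r)" for f r
  have X: "filterlim (X f) at_top at_top" if "filterlim (nevanlinna_T f) at_top at_top" for f
    unfolding X_def[abs_def] by (rule nevanlinna_T_inv_T_at_top[OF that])
  have TX: "eventually (\<lambda>r. X f r > 0 \<and> nevanlinna_T g (X f r) = nevanlinna_T f r) at_top"
    if "filterlim (nevanlinna_T f) at_top at_top" for f
    unfolding X_def by (rule eventually_compose_filterlim[OF eventually_nevanlinna_T_inv[OF g nc] that])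
  define m where "m r = max (X a r) (X b r)" for r
  have m: "filterlim m at_top at_top"
    by (rule filterlim_at_top_mono[OF X[OF a]]) (simp add: m_def)
  \<comment> \<open>T_f is at most 2 T_g(m) + C, which is less than 3 T_g(m) and thus strictly below
    the 4 T_g(m) bounded here.\<close>
  have "eventually (\<lambda>s. 4 * nevanlinna_T g s \<le> nevanlinna_T g (s powr \<sigma>)
       \<and> max C 0 < nevanlinna_T g s \<and> iter_log p (s powr \<sigma>) \<le> \<sigma> * iter_log p s) at_top"
    by (intro eventually_conj property_A_nevanlinna_T[OF g nc A \<sigma>] eventually_iter_log_powr[OF \<sigma> p])
       (use nevanlinna_T_entire_at_top[OF g nc] in \<open>simp only: filterlim_at_top_dense\<close>)
  note evm = eventually_compose_filterlim[OF this m]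
  show ?thesis
    using TX[OF f] TX[OF a] TX[OF b] le evm
      eventually_compose_filterlim[OF eventually_iter_log_mono[of p] X[OF f]]
      eventually_compose_filterlim[OF eventually_iter_log_pos[of q] \<phi>]
  proof eventually_elim
    case (elim r)
    have "nevanlinna_T g (X a r) \<le> nevanlinna_T g (m r)" "nevanlinna_T g (X b r) \<le> nevanlinna_T g (m r)"
      using elim by (intro nevanlinna_T_mono[OF g nc]; simp add: m_def)+
    then have T_less: "nevanlinna_T g (X f r) < nevanlinna_T g (m r powr \<sigma>)"
      using elim by auto
    have "X f r \<le> m r powr \<sigma>"
    proof (rule ccontr)
      assume "\<not> X f r \<le> m r powr \<sigma>"
      moreover have "m r powr \<sigma> > 0" using elim by (auto simp: m_def)
      ultimately have "nevanlinna_T g (m r powr \<sigma>) \<le> nevanlinna_T g (X f r)"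
        by (intro nevanlinna_T_mono[OF g nc]) auto
      then show False using T_less by simp
    qed
    then have "iter_log p (X f r) \<le> iter_log p (m r powr \<sigma>)" using elim by blast
    also have "\<dots> \<le> \<sigma> * iter_log p (m r)" using elim by blast
    also have "\<dots> \<le> \<sigma> * max (iter_log p (X a r)) (iter_log p (X b r))"
      using \<sigma> by (auto simp: m_def max_def)
    finally have "iter_log p (X f r) / iter_log q (\<phi> r)
        \<le> \<sigma> * max (iter_log p (X a r)) (iter_log p (X b r)) / iter_log q (\<phi> r)"
      using elim by (intro divide_right_mono) auto
    also have "\<dots> = \<sigma> * max (iter_log p (X a r) / iter_log q (\<phi> r)) (iter_log p (X b r) / iter_log q (\<phi> r))"
      using elim by (simp add: max_divide_distrib_right flip: times_divide_eq_right)
    finally show ?case by (simp add: growth_quotient_def X_def)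
  qed
qed

lemma Liminf_growth_quotient_le:
  assumes A: "property_A g"
    and f: "filterlim (nevanlinna_T f) at_top at_top"
    and a: "filterlim (nevanlinna_T a) at_top at_top"
    and b: "filterlim (nevanlinna_T b) at_top at_top"
    and le: "eventually (\<lambda>r. nevanlinna_T f r \<le> nevanlinna_T a r + nevanlinna_T b r + C) at_top"
  shows "rel_lower_order p q \<phi> g f \<le> max (rel_lower_order p q \<phi> g a) (rel_order p q \<phi> g b)"
  unfolding rel_lower_order_def rel_order_def
  by (intro Liminf_le_max_Limsup growth_quotient_le_max[OF A _ f a b le] eventually_growth_quotient_nonneg b) auto

text \<open>Used contrapositively: a nonzero lower order rules out functions that are constant off a
  sparse set.\<close>

lemma rel_lower_order_const:
  assumes "eventually (\<lambda>z. f z = c) (cosparse UNIV)"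
  shows "rel_lower_order p q \<phi> g f = 0"
proof -
  define d where "d = iter_log p (nevanlinna_T_inv g (log_plus (cmod c)))"
  have "((\<lambda>r. d / iter_log q (\<phi> r)) \<longlongrightarrow> 0) at_top"
    by (rule tendsto_divide_0[OF tendsto_const filterlim_at_top_imp_at_infinity[OF iter_log_phi_at_top]])
  moreover have "eventually (\<lambda>r. d / iter_log q (\<phi> r) = growth_quotient p q \<phi> g f r) at_top"
    using eventually_gt_at_top[of 0]
    by eventually_elim (simp add: growth_quotient_def d_def nevanlinna_T_const[OF assms])
  ultimately have "(growth_quotient p q \<phi> g f \<longlongrightarrow> 0) at_top"
    by (rule Lim_transform_eventually)
  then have "((\<lambda>r. ereal (growth_quotient p q \<phi> g f r)) \<longlongrightarrow> ereal 0) at_top"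
    by simp
  then show ?thesis unfolding rel_lower_order_def
    by (simp add: lim_imp_Liminf zero_ereal_def)
qed

lemma nonzero_lower_order_imp_at_top:
  assumes "f meromorphic_on UNIV" "nonzero_finite (rel_lower_order p q \<phi> g f)"
  shows "filterlim (nevanlinna_T f) at_top at_top" "nonnull_meromorphic f"
proof -
  have "\<not> eventually (\<lambda>z. f z = c) (cosparse UNIV)" for c
    using assms(2) rel_lower_order_const[of f c] by (auto simp: nonzero_finite_def)
  then show "filterlim (nevanlinna_T f) at_top at_top" "nonnull_meromorphic f"
    using nevanlinna_T_at_top[OF assms(1)] by blast+
qed

text \<open>The regular factor \<open>h\<close> is the one whose lim sup appears in both bounds. The
  second bound treats \<open>f\<close> as the product of \<open>f h\<close> and
  \<open>1 / h\<close>.\<close>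

lemma lower_order_product_le:
  assumes A: "property_A g" and f: "f meromorphic_on UNIV" and h: "h meromorphic_on UNIV"
    and nz: "nonzero_finite (rel_lower_order p q \<phi> g f)" "nonzero_finite (rel_lower_order p q \<phi> g h)"
      "nonzero_finite (rel_lower_order p q \<phi> g (\<lambda>z. f z * h z))"
    and reg: "regular_growth p q \<phi> g h"
  shows "rel_lower_order p q \<phi> g (\<lambda>z. f z * h z) \<le> max (rel_lower_order p q \<phi> g f) (rel_lower_order p q \<phi> g h)"
    and "rel_lower_order p q \<phi> g f \<le> max (rel_lower_order p q \<phi> g (\<lambda>z. f z * h z)) (rel_lower_order p q \<phi> g h)"
proof -
  have fh: "(\<lambda>z. f z * h z) meromorphic_on UNIV" by (intro meromorphic_intros f h)
  note F = nonzero_lower_order_imp_at_top[OF f nz(1)]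
  note H = nonzero_lower_order_imp_at_top[OF h nz(2)]
  note FH = nonzero_lower_order_imp_at_top[OF fh nz(3)]
  have reg': "rel_lower_order p q \<phi> g h = rel_order p q \<phi> g h"
    using reg by (simp add: regular_growth_def)
  have "eventually (\<lambda>r. nevanlinna_T (\<lambda>z. f z * h z) r \<le> nevanlinna_T f r + nevanlinna_T h r + 0) at_top"
    using eventually_ge_at_top[of 1]
    by eventually_elim (simp add: nevanlinna_T_mult_le[OF F(2) H(2)])
  from Liminf_growth_quotient_le[OF A FH(1) F(1) H(1) this]
  show "rel_lower_order p q \<phi> g (\<lambda>z. f z * h z) \<le> max (rel_lower_order p q \<phi> g f) (rel_lower_order p q \<phi> g h)"
    unfolding reg' .
  obtain c where c: "\<And>r. r > 0 \<Longrightarrow> nevanlinna_T (\<lambda>z. inverse (h z)) r = nevanlinna_T h r + c"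
    using nevanlinna_T_inverse[OF H(2)] by blast
  \<comment> \<open>The cancellation can fail where \<open>h\<close> is 0, which happens only on a
    sparse set and leaves the characteristic unchanged.\<close>
  have eq: "eventually (\<lambda>z. f z = f z * h z * inverse (h z)) (cosparse UNIV)"
    using H(2) unfolding nonnull_meromorphic_def by (auto elim!: eventually_mono)
  have "eventually (\<lambda>r. nevanlinna_T f r \<le> nevanlinna_T (\<lambda>z. f z * h z) r + nevanlinna_T h r + c) at_top"
    using eventually_ge_at_top[of 1]
  proof eventually_elim
    case (elim r)
    have "nevanlinna_T f r = nevanlinna_T (\<lambda>z. f z * h z * inverse (h z)) r"
      using elim by (intro nevanlinna_T_cong[OF eq]) auto
    also have "\<dots> \<le> nevanlinna_T (\<lambda>z. f z * h z) r + nevanlinna_T (\<lambda>z. inverse (h z)) r"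
      by (intro nevanlinna_T_mult_le FH nonnull_meromorphic_inverse H elim)
    finally show ?case using c[of r] elim by simp
  qed
  from Liminf_growth_quotient_le[OF A F(1) FH(1) H(1) this]
  show "rel_lower_order p q \<phi> g f \<le> max (rel_lower_order p q \<phi> g (\<lambda>z. f z * h z)) (rel_lower_order p q \<phi> g h)"
    unfolding reg' .
qed

end

lemma mono_unbounded_at_top:
  fixes \<phi> :: "real \<Rightarrow> real"
  assumes "mono_on {0..} \<phi>" "\<not> bdd_above (\<phi> ` {0..})"
  shows "filterlim \<phi> at_top at_top"
  unfolding filterlim_at_top
proof
  fix B
  obtain x where x: "x \<ge> 0" "\<phi> x > B"
    using assms(2) by (auto simp: bdd_above_def not_le)
  show "eventually (\<lambda>r. B \<le> \<phi> r) at_top"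
    using eventually_ge_at_top[of x]
  proof eventually_elim
    case (elim r)
    then have "\<phi> x \<le> \<phi> r" using x by (intro mono_onD[OF assms(1)]) auto
    then show ?case using x by simp
  qed
qed

theorem theorem7:
  fixes p q :: nat and \<phi> :: "real \<Rightarrow> real" and f1 f2 g1 :: "complex \<Rightarrow> complex"
  assumes "p > 0" and "q > 0"
    and "\<And>x. x \<ge> 0 \<Longrightarrow> \<phi> x > 0"
    and "mono_on {0..} \<phi>"
    and "\<not> bdd_above (\<phi> ` {0..})"
    and "f1 meromorphic_on UNIV" and "f2 meromorphic_on UNIV"
    and "g1 holomorphic_on UNIV" and "\<not> g1 constant_on UNIV"
    and "nonzero_finite (rel_lower_order p q \<phi> g1 f1)"
    and "nonzero_finite (rel_lower_order p q \<phi> g1 f2)"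
    and "nonzero_finite (rel_lower_order p q \<phi> g1 (\<lambda>z. f1 z * f2 z))"
    and "nonzero_finite (rel_order p q \<phi> g1 f1)"
    and "nonzero_finite (rel_order p q \<phi> g1 f2)"
    and "regular_growth p q \<phi> g1 f1 \<or> regular_growth p q \<phi> g1 f2"
    and "property_A g1"
  shows "rel_lower_order p q \<phi> g1 (\<lambda>z. f1 z * f2 z)
           \<le> max (rel_lower_order p q \<phi> g1 f1) (rel_lower_order p q \<phi> g1 f2)
       \<and> (rel_lower_order p q \<phi> g1 f1 > rel_lower_order p q \<phi> g1 f2 \<and> regular_growth p q \<phi> g1 f2
           \<longrightarrow> rel_lower_order p q \<phi> g1 (\<lambda>z. f1 z * f2 z)
                 = max (rel_lower_order p q \<phi> g1 f1) (rel_lower_order p q \<phi> g1 f2))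
       \<and> (rel_lower_order p q \<phi> g1 f2 > rel_lower_order p q \<phi> g1 f1 \<and> regular_growth p q \<phi> g1 f1
           \<longrightarrow> rel_lower_order p q \<phi> g1 (\<lambda>z. f1 z * f2 z)
                 = max (rel_lower_order p q \<phi> g1 f1) (rel_lower_order p q \<phi> g1 f2))"
proof -
  note h = assms
  have \<phi>: "filterlim \<phi> at_top at_top" using h(4,5) by (rule mono_unbounded_at_top)
  note P = lower_order_product_le[OF h(1) \<phi> h(8,9,16)]
  have comm: "(\<lambda>z. f1 z * f2 z) = (\<lambda>z. f2 z * f1 z)" by (simp add: mult.commute)
  note P12 = P[OF h(6,7,10,11,12)] and P21 = P[OF h(7,6,11,10) h(12)[unfolded comm], folded comm]
  let ?l1 = "rel_lower_order p q \<phi> g1 f1" and ?l2 = "rel_lower_order p q \<phi> g1 f2"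
    and ?l12 = "rel_lower_order p q \<phi> g1 (\<lambda>z. f1 z * f2 z)"
  have upper: "?l12 \<le> max ?l1 ?l2"
    using h(15) P12(1) P21(1) by (auto simp: max.commute)
  \<comment> \<open>The second bound reads \<open>?l1 \<le> max ?l12 ?l2\<close>; as
    \<open>?l2 < ?l1\<close>, the maximum must be \<open>?l12\<close>.\<close>
  moreover have "?l12 = max ?l1 ?l2" if "?l1 > ?l2" "regular_growth p q \<phi> g1 f2"
    using P12(2)[OF that(2)] upper that(1) by (auto simp: max_def split: if_splits)
  moreover have "?l12 = max ?l1 ?l2" if "?l2 > ?l1" "regular_growth p q \<phi> g1 f1"
    using P21(2)[OF that(2)] upper that(1) by (auto simp: max_def split: if_splits)
  ultimately show ?thesis by blast
qed

end
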